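(* For any formula $\phi(\mathbf{x},\mathbf{y})$, $\mathrm{VCm}(\phi) = \mathrm{VCd}_{\mathrm{ind}}(\phi)$.
   Context: Fix a complete first-order theory $T$ with a large saturated (monster, in particular infinite) model $\mathfrak{M}$ with universe $\mathrm{M}$. Formulas are partitioned, $\phi(\mathbf{x},\mathbf{y})$, with $\mathbf{x}=\langle x_1,\ldots,x_l\rangle$ and $\mathbf{y}=\langle y_1,\ldots,y_k\rangle$ finite nonempty tuples of variables; $|\mathbf{x}|=l$, $|\mathbf{y}|=k$. For $A\subseteq \mathrm{M}^{|\mathbf{y}|}$, $S_\phi(A)$ is the set of $\phi$-types over $A$, i.e. maximal consistent sets of formulas of the form $\pm\phi(\mathbf{x},\mathbf{a})$, $\mathbf{a}\in A$. A type $p\in S_\phi(A)$ is identified with the subset $\{\mathbf{a}\in A:\phi(\mathbf{x},\mathbf{a})\in p\}$ of $A$, so $S_\phi(A)\subseteq\mathcal{P}(A)$. Maximum set systems: for a set $X$, $\mathcal{C}\subseteq\mathcal{P}(X)$ and $A\subseteq X$, let $\mathcal{C}|^A=\{C\cap A: C\in\mathcal{C}\}$. For $d\in\omega$, $\mathcal{C}$ is $d$-maximum (on $X$) if for every finite $A\subseteq X$, $|\mathcal{C}|^A|=\binom{|A|}{\leq d}$, where $\binom{n}{\leq k}$ denotes $\sum_{i=0}^k\binom{n}{i}$ if $k<n$ and $2^n$ otherwise. Traces: for $A\subseteq \mathrm{M}^{|\mathbf{y}|}$, $Tr(\phi,A)=\mathcal{P}(S_\phi(A))$, so an element $\mathcal{C}$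 of $Tr(\phi,A)$ is a family of subsets of $A$ (regarded as a set system on $A$). For a cardinal $\kappa$, $Tr_\kappa(\phi)=\bigcup\{Tr(\phi,A): A\subseteq \mathrm{M}^{|\mathbf{y}|}, |A|=\kappa\}$. $\mathrm{VCm}(\phi)$ is the maximum of the $d\in\omega$ such that some $\mathcal{C}\in Tr_{\aleph_0}(\phi)$ is $d$-maximum (on the corresponding countably infinite set $A$), and $\mathrm{VCm}(\phi)=\infty$ if there are arbitrarily large such $d$. For $r\in\mathbb{R}$, $\mathrm{VCd}_{\mathrm{ind}}(\phi)\leq r$ means: there is $K\in\omega$ such that for every nonempty finite indiscernible sequence $\bar{\mathbf{b}}=\langle\mathbf{b}_i:i<N\rangle$ of elements of $\mathrm{M}^{|\mathbf{y}|}$, $|S_\phi(\mathrm{range}(\bar{\mathbf{b}}))|<K\cdot N^r$. $\mathrm{VCd}_{\mathrm{ind}}(\phi)$ is the infimum of all such $r$, and is $\infty$ if there is none. *)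

theory Defs
  imports Complex_Main "HOL-Library.Equipollence" "HOL-Library.Extended_Real"
begin

text \<open>First-order languages with equality. A symbol belongs to the language iff its arity is
  not \<open>None\<close>, so a language may have no function symbols or no relation symbols; constants are
  function symbols of arity 0.\<close>

record ('f, 'r) language =
  fun_arity :: "'f \<rightharpoonup> nat"
  rel_arity :: "'r \<rightharpoonup> nat"

datatype 'f tm = Var nat | App 'f "'f tm list"

datatype ('f, 'r) fm =
    Eq "'f tm" "'f tm"
  | Rel 'r "'f tm list"
  | Neg "('f, 'r) fm"
  | Conj "('f, 'r) fm" "('f, 'r) fm"
  | Exists nat "('f, 'r) fm"

primrec fv_tm :: "'f tm \<Rightarrow> nat set" where
  "fv_tm (Var v) = {v}"
| "fv_tm (App f ts) = \<Union> (set (map fv_tm ts))"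

primrec wf_tm :: "('f, 'r) language \<Rightarrow> 'f tm \<Rightarrow> bool" where
  "wf_tm L (Var v) \<longleftrightarrow> True"
| "wf_tm L (App f ts) \<longleftrightarrow> fun_arity L f = Some (length ts) \<and> list_all id (map (wf_tm L) ts)"

primrec fv :: "('f, 'r) fm \<Rightarrow> nat set" where
  "fv (Eq s t) = fv_tm s \<union> fv_tm t"
| "fv (Rel r ts) = \<Union> (set (map fv_tm ts))"
| "fv (Neg \<psi>) = fv \<psi>"
| "fv (Conj \<psi> \<chi>) = fv \<psi> \<union> fv \<chi>"
| "fv (Exists v \<psi>) = fv \<psi> - {v}"

primrec wf_fm :: "('f, 'r) language \<Rightarrow> ('f, 'r) fm \<Rightarrow> bool" where
  "wf_fm L (Eq s t) \<longleftrightarrow> wf_tm L s \<and> wf_tm L t"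
| "wf_fm L (Rel r ts) \<longleftrightarrow> rel_arity L r = Some (length ts) \<and> (\<forall>t\<in>set ts. wf_tm L t)"
| "wf_fm L (Neg \<psi>) \<longleftrightarrow> wf_fm L \<psi>"
| "wf_fm L (Conj \<psi> \<chi>) \<longleftrightarrow> wf_fm L \<psi> \<and> wf_fm L \<chi>"
| "wf_fm L (Exists v \<psi>) \<longleftrightarrow> wf_fm L \<psi>"

definition formulas :: "('f, 'r) language \<Rightarrow> ('f, 'r) fm set" where
  "formulas L = {\<psi>. wf_fm L \<psi>}"

definition sentences :: "('f, 'r) language \<Rightarrow> ('f, 'r) fm set" where
  "sentences L = {\<psi> \<in> formulas L. fv \<psi> = {}}"

text \<open>The universe of a structure is the whole type \<open>'m\<close>. Interpretations are total on argument
  lists, but well-formed formulas only ever use them at lists of the right length.\<close>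

record ('f, 'r, 'm) struct =
  fun_interp :: "'f \<Rightarrow> 'm list \<Rightarrow> 'm"
  rel_interp :: "'r \<Rightarrow> 'm list \<Rightarrow> bool"

primrec val :: "('f, 'r, 'm) struct \<Rightarrow> (nat \<Rightarrow> 'm) \<Rightarrow> 'f tm \<Rightarrow> 'm" where
  "val M e (Var v) = e v"
| "val M e (App f ts) = fun_interp M f (map (val M e) ts)"

primrec sat :: "('f, 'r, 'm) struct \<Rightarrow> (nat \<Rightarrow> 'm) \<Rightarrow> ('f, 'r) fm \<Rightarrow> bool" where
  "sat M e (Eq s t) \<longleftrightarrow> val M e s = val M e t"
| "sat M e (Rel r ts) \<longleftrightarrow> rel_interp M r (map (val M e) ts)"
| "sat M e (Neg \<psi>) \<longleftrightarrow> \<not> sat M e \<psi>"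
| "sat M e (Conj \<psi> \<chi>) \<longleftrightarrow> sat M e \<psi> \<and> sat M e \<chi>"
| "sat M e (Exists v \<psi>) \<longleftrightarrow> (\<exists>c. sat M (e(v := c)) \<psi>)"

definition is_model :: "('f, 'r, 'm) struct \<Rightarrow> ('f, 'r) fm set \<Rightarrow> bool" where
  "is_model M T \<longleftrightarrow> (\<forall>\<psi>\<in>T. \<forall>e. sat M e \<psi>)"

text \<open>Theories are taken to be deductively closed, so completeness is a condition on membership;
  satisfiability comes from the model that accompanies \<open>T\<close>.\<close>

definition complete_theory :: "('f, 'r) language \<Rightarrow> ('f, 'r) fm set \<Rightarrow> bool" where
  "complete_theory L T \<longleftrightarrow> T \<subseteq> sentences L \<and> (\<forall>\<psi>\<in>sentences L. \<psi> \<in> T \<or> Neg \<psi> \<in> T)"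

text \<open>A formula with parameters from \<open>A\<close> and free variable \<open>0\<close> is a pair \<open>(\<psi>, e)\<close>, where \<open>e\<close>
  supplies the parameters for the other free variables of \<open>\<psi>\<close>. A set of such formulas is consistent
  with the elementary diagram of \<open>M\<close> iff it is finitely satisfiable in \<open>M\<close>.\<close>

definition saturated :: "('f, 'r) language \<Rightarrow> ('f, 'r, 'm) struct \<Rightarrow> bool" where
  "saturated L M \<longleftrightarrow>
     (\<forall>(A :: 'm set) p.
        A \<prec> (UNIV :: 'm set) \<and>
        p \<subseteq> {(\<psi>, e). \<psi> \<in> formulas L \<and> (\<forall>v \<in> fv \<psi> - {0}. e v \<in> A)} \<and>
        (\<forall>q \<subseteq> p. finite q \<longrightarrow> (\<exists>c. \<forall>(\<psi>, e) \<in> q. sat M (e(0 := c)) \<psi>)) \<longrightarrow>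
        (\<exists>c. \<forall>(\<psi>, e) \<in> p. sat M (e(0 := c)) \<psi>))"

text \<open>Largeness means cardinality above \<open>|L| + \<aleph>\<^sub>0\<close>, the number of formulas; in particular
  the model is infinite.\<close>

definition monster_model ::
    "('f, 'r) language \<Rightarrow> ('f, 'r) fm set \<Rightarrow> ('f, 'r, 'm) struct \<Rightarrow> bool" where
  "monster_model L T M \<longleftrightarrow>
     is_model M T \<and> saturated L M \<and> formulas L \<prec> (UNIV :: 'm set)"

record ('f, 'r) part_fm =
  body :: "('f, 'r) fm"
  xvars :: "nat list"
  yvars :: "nat list"

definition partitioned_formula :: "('f, 'r) language \<Rightarrow> ('f, 'r) part_fm \<Rightarrow> bool" where
  "partitioned_formula L \<phi> \<longleftrightarrow>
     body \<phi> \<in> formulas L \<and> xvars \<phi> \<noteq> [] \<and> yvars \<phi> \<noteq> [] \<and>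
     distinct (xvars \<phi> @ yvars \<phi>) \<and> fv (body \<phi>) \<subseteq> set (xvars \<phi> @ yvars \<phi>)"

definition tuples :: "nat \<Rightarrow> 'm list set" where
  "tuples n = {as. length as = n}"

definition assign :: "nat list \<Rightarrow> 'm list \<Rightarrow> nat \<Rightarrow> 'm" where
  "assign vs as v = the (map_of (zip vs as) v)"

definition holds :: "('f, 'r, 'm) struct \<Rightarrow> ('f, 'r) part_fm \<Rightarrow> 'm list \<Rightarrow> 'm list \<Rightarrow> bool" where
  "holds M \<phi> c a \<longleftrightarrow> sat M (assign (xvars \<phi> @ yvars \<phi>) (c @ a)) (body \<phi>)"

text \<open>The pair \<open>(s, a)\<close> stands for \<open>\<phi>(x, a)\<close> if \<open>s\<close> is true and for its negation otherwise.\<close>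

definition phi_consistent ::
    "('f, 'r, 'm) struct \<Rightarrow> ('f, 'r) part_fm \<Rightarrow> (bool \<times> 'm list) set \<Rightarrow> bool" where
  "phi_consistent M \<phi> p \<longleftrightarrow>
     (\<forall>q \<subseteq> p. finite q \<longrightarrow>
        (\<exists>c \<in> tuples (length (xvars \<phi>)). \<forall>(s, a) \<in> q. holds M \<phi> c a \<longleftrightarrow> s))"

definition is_phi_type ::
    "('f, 'r, 'm) struct \<Rightarrow> ('f, 'r) part_fm \<Rightarrow> 'm list set \<Rightarrow> (bool \<times> 'm list) set \<Rightarrow> bool" where
  "is_phi_type M \<phi> A p \<longleftrightarrow>
     p \<subseteq> UNIV \<times> A \<and> phi_consistent M \<phi> p \<and>
     (\<forall>q. p \<subseteq> q \<and> q \<subseteq> UNIV \<times> A \<and> phi_consistent M \<phi> q \<longrightarrow> q = p)"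

text \<open>\<open>S\<^sub>\<phi>(A)\<close>, with each type identified with a subset of \<open>A\<close>.\<close>

definition phi_types ::
    "('f, 'r, 'm) struct \<Rightarrow> ('f, 'r) part_fm \<Rightarrow> 'm list set \<Rightarrow> 'm list set set" where
  "phi_types M \<phi> A = {{a \<in> A. (True, a) \<in> p} | p. is_phi_type M \<phi> A p}"

definition binom_le :: "nat \<Rightarrow> nat \<Rightarrow> nat" where
  "binom_le n k = (if k < n then (\<Sum>i\<le>k. n choose i) else 2 ^ n)"

definition restrict_sys :: "'a set set \<Rightarrow> 'a set \<Rightarrow> 'a set set" where
  "restrict_sys \<C> A = {C \<inter> A | C. C \<in> \<C>}"

definition maximum_sys :: "nat \<Rightarrow> 'a set \<Rightarrow> 'a set set \<Rightarrow> bool" where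
  "maximum_sys d X \<C> \<longleftrightarrow>
     \<C> \<subseteq> Pow X \<and>
     (\<forall>A. finite A \<and> A \<subseteq> X \<longrightarrow> card (restrict_sys \<C> A) = binom_le (card A) d)"

definition traces ::
    "('f, 'r, 'm) struct \<Rightarrow> ('f, 'r) part_fm \<Rightarrow> 'm list set \<Rightarrow> 'm list set set set" where
  "traces M \<phi> A = Pow (phi_types M \<phi> A)"

text \<open>A supremum in \<^typ>\<open>enat\<close>: the maximum if the set of \<open>d\<close> is finite and nonempty, and \<open>\<infinity>\<close> if
  it is infinite. It always contains 0 when the universe is infinite.\<close>

definition VCm :: "('f, 'r, 'm) struct \<Rightarrow> ('f, 'r) part_fm \<Rightarrow> enat" where
  "VCm M \<phi> =
     (SUP d \<in> {d. \<exists>A \<subseteq> tuples (length (yvars \<phi>)). A \<approx> (UNIV :: nat set) \<and>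
                     (\<exists>\<C> \<in> traces M \<phi> A. maximum_sys d A \<C>)}. enat d)"

text \<open>\<open>bs\<close> is a sequence of \<open>k\<close>-tuples; \<open>is\<close> and \<open>js\<close> are increasing sequences of positions in
  it. The formula \<open>\<psi>\<close> has no parameters.\<close>

definition indiscernible ::
    "('f, 'r) language \<Rightarrow> ('f, 'r, 'm) struct \<Rightarrow> nat \<Rightarrow> 'm list list \<Rightarrow> bool" where
  "indiscernible L M k bs \<longleftrightarrow>
     set bs \<subseteq> tuples k \<and>
     (\<forall>is js vs. \<forall>\<psi> \<in> formulas L.
        sorted_wrt (<) is \<and> set is \<subseteq> {..<length bs} \<and>
        sorted_wrt (<) js \<and> set js \<subseteq> {..<length bs} \<and>
        length js = length is \<and>
        distinct vs \<and> length vs = length is * k \<and> fv \<psi> \<subseteq> set vs \<longrightarrow>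
        (sat M (assign vs (concat (map (\<lambda>i. bs ! i) is))) \<psi> \<longleftrightarrow>
         sat M (assign vs (concat (map (\<lambda>j. bs ! j) js))) \<psi>))"

definition VCd_ind_le ::
    "('f, 'r) language \<Rightarrow> ('f, 'r, 'm) struct \<Rightarrow> ('f, 'r) part_fm \<Rightarrow> real \<Rightarrow> bool" where
  "VCd_ind_le L M \<phi> r \<longleftrightarrow>
     (\<exists>K :: nat. \<forall>bs. bs \<noteq> [] \<and> indiscernible L M (length (yvars \<phi>)) bs \<longrightarrow>
        real (card (phi_types M \<phi> (set bs))) < real K * real (length bs) powr r)"

definition VCd_ind :: "('f, 'r) language \<Rightarrow> ('f, 'r, 'm) struct \<Rightarrow> ('f, 'r) part_fm \<Rightarrow> ereal" where
  "VCd_ind L M \<phi> = Inf {ereal r | r. VCd_ind_le L M \<phi> r}"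

end

theory Submission
  imports Defs "HOL-Library.Sublist" "HOL-Library.Ramsey"
begin

text \<open>A \<open>d\<close>-maximum trace yields, by Ramsey's theorem and compactness, indiscernible
  sequences of every length \<open>N\<close> with at least \<open>binom_le N d\<close> types, which forces \<open>d \<le> r\<close>.
  Conversely, a type over an indiscernible sequence is a 0/1-word, and whether a word is realised
  on a subsequence does not depend on the chosen positions. Only \<open>O(N ^ d)\<close> words of length \<open>N\<close>
  omit every word \<open>c\<^sub>0\<^sup>m (\<not> c\<^sub>0) c\<^sub>1\<^sup>m (\<not> c\<^sub>1) \<dots> c\<^bsub>d+1\<^esub>\<^sup>m\<close> as a subsequence, so if the
  exponent \<open>d\<close> fails, one choice of \<open>c\<close> is realised for all \<open>m\<close>. The words that omit the
  subsequence \<open>(\<not> c\<^sub>0) \<dots> (\<not> c\<^bsub>d+1\<^esub>)\<close> are subsequences of these. They form a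
  \<open>(d+1)\<close>-maximum system, which compactness realises on an infinite sequence.\<close>

section \<open>Words and maximum set systems\<close>

text \<open>The exponent is a count of degrees of freedom. A word that omits all block words with
  \<open>d + 1\<close> separators splits into at most \<open>d + 1\<close> pieces and a bounded
  tail; each piece is a prefix of at most \<open>2 * m\<close> letters, a run of one letter and a
  separator. Only the run lengths are unbounded, and the total length fixes one of them, which
  leaves \<open>d\<close>. The long runs are forced by the other side of the argument: a jump word
  may stay at one letter for any time before it jumps, and indiscernibility passes from a word to
  its subsequences only. The letters cannot be prescribed, since the word itself decides which
  letter is frequent. So they may vary with \<open>m\<close>, until finiteness of the choices and
  monotonicity in \<open>m\<close> fix them. Each of the \<open>d + 1\<close> separators leaves room
  for one jump, hence dimension \<open>d + 1\<close>. In the first direction the obstacle is that a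
  maximum trace lives on a set without any homogeneity, and that a number of types is not a property
  of one increasing tuple. What is transferred is the set of realised words of length
  \<open>N\<close>, each being one definable condition.\<close>

primrec block_word :: "nat \<Rightarrow> bool list \<Rightarrow> bool \<Rightarrow> bool list" where
  "block_word m [] c = replicate m c"
| "block_word m (c' # cs) c = replicate m c' @ (\<not> c') # block_word m cs c"

text \<open>The index \<open>k\<close> counts separators, so the forbidden words have
  \<open>k + 1\<close> runs. It governs the growth of the number of words; \<open>m\<close> only
  enters the constants.\<close>

definition block_free :: "nat \<Rightarrow> nat \<Rightarrow> bool list set" where
  "block_free m k = {w. \<forall>cs c. length cs = k \<longrightarrow> \<not> subseq (block_word m cs c) w}"

lemma finite_bool_lists_le: "finite {w :: bool list. length w \<le> n}"
  using finite_lists_length_le[of "UNIV :: bool set" n] by simp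

text \<open>One of the two letters fills at least half of \<open>u\<close>, and its occurrences form
  a subsequence.\<close>

lemma bool_replicate_subseq:
  fixes u :: "bool list"
  assumes "length u \<ge> 2 * m"
  obtains c where "subseq (replicate m c) u"
proof -
  have sub: "subseq (replicate m c) u" if "m \<le> length (filter ((=) c) u)" for c
  proof -
    have "filter ((=) c) u = replicate (length (filter ((=) c) u)) c"
      by (induction u) auto
    then have "subseq (replicate (length (filter ((=) c) u)) c) u"
      by (metis subseq_filter_left)
    moreover have "replicate (length (filter ((=) c) u)) c
        = replicate m c @ replicate (length (filter ((=) c) u) - m) c"
      using that by (simp flip: replicate_add)
    ultimately show ?thesis
      by (metis list_emb_appendD subseq_order.order_trans subseq_rev_drop_many subseq_order.order_refl)
  qed
  have "length (filter ((=) True) u) + length (filter ((=) False) u) = length u"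
    by (induction u) auto
  then have "m \<le> length (filter ((=) True) u) \<or> m \<le> length (filter ((=) False) u)"
    using assms by linarith
  with sub that show ?thesis by blast
qed

lemma block_free_0: "block_free m 0 \<subseteq> {w. length w \<le> 2 * m}"
proof
  fix w assume w: "w \<in> block_free m 0"
  show "w \<in> {w. length w \<le> 2 * m}"
  proof (rule ccontr)
    assume "w \<notin> {w. length w \<le> 2 * m}"
    then obtain c where "subseq (replicate m c) w"
      using bool_replicate_subseq[of m w] by auto
    then show False using w by (auto simp: block_free_def)
  qed
qed

text \<open>Some \<open>c\<close> occurs \<open>m\<close> times among the first \<open>2 * m\<close>
  letters. The next \<open>\<not> c\<close> after them can serve as a separator, so the rest
  \<open>w'\<close> must omit the block words with one separator fewer. Up to that point only
  \<open>c\<close> is seen, which is the run of length \<open>j\<close>.\<close>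

lemma block_free_Suc:
  assumes w: "w \<in> block_free m (Suc k)"
  obtains u c j where "length u \<le> 2 * m" "w = u @ replicate j c"
  | u c j w' where "length u \<le> 2 * m" "w = u @ replicate j c @ (\<not> c) # w'" "w' \<in> block_free m k"
proof (cases "length w \<le> 2 * m")
  case True
  then show ?thesis using that(1)[of w 0] by simp
next
  case False
  define u where "u = take (2 * m) w"
  have lu: "length u = 2 * m" using False by (simp add: u_def)
  then obtain c where c: "subseq (replicate m c) u"
    using bool_replicate_subseq[of m u] by auto
  define v where "v = drop (2 * m) w"
  define j where "j = length (takeWhile ((=) c) v)"
  have tw: "takeWhile ((=) c) v = replicate j c"
    unfolding j_def by (induction v) auto
  have wuv: "w = u @ replicate j c @ dropWhile ((=) c) v"
    unfolding tw[symmetric] by (simp add: u_def v_def)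
  show ?thesis
  proof (cases "dropWhile ((=) c) v")
    case Nil
    then show ?thesis using that(1)[of u j c] lu wuv by simp
  next
    case (Cons b w')
    have b: "b = (\<not> c)"
      using hd_dropWhile[of "(=) c" v] Cons by auto
    have "w' \<in> block_free m k"
      unfolding block_free_def
    proof (intro CollectI allI impI notI)
      fix cs d assume cs: "length cs = k" and s: "subseq (block_word m cs d) w'"
      have "subseq (replicate m c @ (\<not> c) # block_word m cs d) (u @ (replicate j c @ (\<not> c) # w'))"
        by (rule list_emb_append_mono[OF c subseq_drop_many]) (use s in simp)
      then have "subseq (block_word m (c # cs) d) w"
        unfolding wuv Cons b by simp
      moreover have "length (c # cs) = Suc k" using cs by simp
      ultimately show False using w unfolding block_free_def by blast
    qed
    then show ?thesis using that(2)[of u j c w'] lu wuv Cons b by simp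
  qed
qed

text \<open>The exponent \<open>j\<close> in the decomposition of \<open>block_free_Suc\<close> is determined by the total
  length.\<close>

lemma card_block_free_Suc:
  "card {w \<in> block_free m (Suc k). length w = N}
    \<le> card {u :: bool list. length u \<le> 2 * m} * (2 * Suc (card {w \<in> block_free m k. length w \<le> N}))"
proof -
  let ?U = "{u :: bool list. length u \<le> 2 * m}"
  let ?W = "{w \<in> block_free m k. length w \<le> N}"
  \<comment> \<open>\<open>None\<close> stands for the words whose run reaches the end. The exponent
    of the run in \<open>g\<close> is whatever fills the word up to length \<open>N\<close>.\<close>
  define tail where "tail c r = (case r of None \<Rightarrow> [] | Some w' \<Rightarrow> (\<not> c) # w')" for c and r :: "bool list option"
  define g where "g = (\<lambda>(u :: bool list, c, r). u @ replicate (N - length u - length (tail c r)) c @ tail c r)"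
  have finW: "finite ?W"
    by (rule finite_subset[OF _ finite_bool_lists_le[of N]]) auto
  have "{w \<in> block_free m (Suc k). length w = N}
    \<subseteq> g ` (?U \<times> (UNIV :: bool set) \<times> insert None (Some ` ?W))"
  proof
    fix w assume "w \<in> {w \<in> block_free m (Suc k). length w = N}"
    then have w: "w \<in> block_free m (Suc k)" and len: "length w = N" by auto
    from w show "w \<in> g ` (?U \<times> (UNIV :: bool set) \<times> insert None (Some ` ?W))"
    proof (cases rule: block_free_Suc)
      case (1 u c j)
      then have "w = g (u, c, None)" using len by (auto simp: g_def tail_def)
      then show ?thesis using 1 by blast
    next
      case (2 u c j w')
      then have "w = g (u, c, Some w')" using len by (auto simp: g_def tail_def)
      moreover have "length w' \<le> N" using 2 len by auto
      ultimately show ?thesis using 2 by blast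
    qed
  qed
  then have "card {w \<in> block_free m (Suc k). length w = N}
      \<le> card (g ` (?U \<times> (UNIV :: bool set) \<times> insert None (Some ` ?W)))"
    by (rule card_mono[rotated]) (use finW finite_bool_lists_le in auto)
  also have "\<dots> \<le> card (?U \<times> (UNIV :: bool set) \<times> insert None (Some ` ?W))"
    by (rule card_image_le) (use finW finite_bool_lists_le in auto)
  also have "\<dots> = card ?U * (2 * Suc (card ?W))"
    using finW by (simp add: card_cartesian_product card_image)
  finally show ?thesis .
qed

text \<open>At a fixed length, one more separator costs a constant factor; summing over the lengths
  up to \<open>N\<close> adds one factor \<open>Suc N\<close>. The bound uses \<open>Suc N\<close>
  because the empty word is counted even for \<open>N = 0\<close>.\<close>

lemma card_block_free_le:
  "\<exists>K. \<forall>N. card {w \<in> block_free m k. length w \<le> N} \<le> K * Suc N ^ k"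
proof (induction k)
  case 0
  have "card {w \<in> block_free m 0. length w \<le> N} \<le> card {w :: bool list. length w \<le> 2 * m}" for N
    by (rule card_mono[OF finite_bool_lists_le]) (use block_free_0 in auto)
  then show ?case by auto
next
  case (Suc k)
  then obtain K where K: "\<And>N. card {w \<in> block_free m k. length w \<le> N} \<le> K * Suc N ^ k" by blast
  define U where "U = card {u :: bool list. length u \<le> 2 * m}"
  have "card {w \<in> block_free m (Suc k). length w \<le> N} \<le> U * (2 * Suc K) * Suc N ^ Suc k" for N
  proof -
    have "{w \<in> block_free m (Suc k). length w \<le> N}
        = (\<Union>n\<le>N. {w \<in> block_free m (Suc k). length w = n})" by auto
    then have "card {w \<in> block_free m (Suc k). length w \<le> N}
        \<le> (\<Sum>n\<le>N. card {w \<in> block_free m (Suc k). length w = n})"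
      by (simp add: card_UN_le)
    also have "\<dots> \<le> (\<Sum>n\<le>N. U * (2 * Suc K) * Suc N ^ k)"
    proof (rule sum_mono)
      fix n assume n: "n \<in> {..N}"
      have "K * Suc n ^ k \<le> K * Suc N ^ k"
        using n by (intro mult_le_mono power_mono) auto
      moreover have "1 \<le> Suc N ^ k" by simp
      ultimately have "Suc (card {w \<in> block_free m k. length w \<le> n}) \<le> Suc K * Suc N ^ k"
        using K[of n] unfolding mult_Suc by linarith
      then show "card {w \<in> block_free m (Suc k). length w = n} \<le> U * (2 * Suc K) * Suc N ^ k"
        using card_block_free_Suc[of m k n] unfolding U_def[symmetric]
        by (smt (verit) mult.assoc mult_le_mono2 order_trans)
    qed
    also have "\<dots> = U * (2 * Suc K) * Suc N ^ Suc k" by (simp add: algebra_simps)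
    finally show ?thesis .
  qed
  then show ?case by blast
qed

text \<open>With the length fixed, the outermost summation over lengths is saved. Hence the exponent
  \<open>d\<close> although \<open>Suc d\<close> separators are forbidden.\<close>

lemma card_block_free_length:
  obtains K where "\<And>N. card {w \<in> block_free m (Suc d). length w = N} \<le> K * Suc N ^ d"
proof -
  obtain K where K: "\<And>N. card {w \<in> block_free m d. length w \<le> N} \<le> K * Suc N ^ d"
    using card_block_free_le by blast
  define U where "U = card {u :: bool list. length u \<le> 2 * m}"
  have "card {w \<in> block_free m (Suc d). length w = N} \<le> U * (2 * Suc K) * Suc N ^ d" for N
  proof -
    have "1 \<le> Suc N ^ d" by simp
    then have "Suc (card {w \<in> block_free m d. length w \<le> N}) \<le> Suc K * Suc N ^ d"
      using K[of N] unfolding mult_Suc by linarith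
    then show ?thesis
      using card_block_free_Suc[of m d N] unfolding U_def[symmetric]
      by (smt (verit) mult.assoc mult_le_mono2 order_trans)
  qed
  then show ?thesis using that by blast
qed

section \<open>Jump sets: an explicit maximum system whose words embed in block words\<close>

lemma subseq_block_word_mono:
  "m \<le> m' \<Longrightarrow> subseq (block_word m cs c) (block_word m' cs c)"
proof (induction cs)
  case Nil
  then have "block_word m' [] c = replicate m c @ replicate (m' - m) c"
    by (simp flip: replicate_add)
  then show ?case by (metis block_word.simps(1) subseq_order.order_refl subseq_rev_drop_many)
next
  case (Cons d cs)
  then have "replicate m' d = replicate m d @ replicate (m' - m) d"
    by (simp flip: replicate_add)
  then have "subseq (replicate m d) (replicate m' d)"
    by (metis subseq_order.order_refl subseq_rev_drop_many)
  then show ?case using Cons by (auto intro: list_emb_append_mono)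
qed

text \<open>Membership is decided by scanning: \<open>i \<in> jump_set c J\<close> is \<open>c r\<close> on the points outside
  \<open>J\<close> and \<open>\<not> c r\<close> on those of \<open>J\<close>, where \<open>r\<close> counts the points of \<open>J\<close> already passed. The sets
  with \<open>card J \<le> D\<close> are those whose characteristic word omits the subsequence
  \<open>\<not> c 0, \<dots>, \<not> c D\<close>.\<close>

definition jump_set :: "(nat \<Rightarrow> bool) \<Rightarrow> nat set \<Rightarrow> nat set" where
  "jump_set c J = {i. c (card (J \<inter> {..<i})) \<noteq> (i \<in> J)}"

lemma card_Int_lessThan_Suc:
  "card (J \<inter> {..<Suc i}) = card (J \<inter> {..<i}) + (if i \<in> J then 1 else 0)"
proof -
  have "J \<inter> {..<Suc i} = (if i \<in> J then insert i (J \<inter> {..<i}) else J \<inter> {..<i})"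
    by (auto simp: lessThan_Suc)
  then show ?thesis by simp
qed

text \<open>\<open>J\<close> is recovered by scanning upwards: once it is known below
  \<open>i\<close>, the current letter is known, and a point \<open>i\<close> of \<open>I\<close>
  lies in \<open>J\<close> iff its membership differs from that letter.\<close>

lemma inj_on_jump_set: "inj_on (\<lambda>J. jump_set c J \<inter> I) (Pow I)"
proof (rule inj_onI)
  fix J J' assume J: "J \<in> Pow I" "J' \<in> Pow I" and eq: "jump_set c J \<inter> I = jump_set c J' \<inter> I"
  have "i \<in> J \<longleftrightarrow> i \<in> J'" for i
  proof (induction i rule: less_induct)
    case (less i)
    then have "J \<inter> {..<i} = J' \<inter> {..<i}" by auto
    moreover have "i \<in> I \<Longrightarrow> i \<in> jump_set c J \<longleftrightarrow> i \<in> jump_set c J'"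
      using eq by blast
    ultimately show ?case using J by (auto simp: jump_set_def)
  qed
  then show "J = J'" by blast
qed

text \<open>A code inside \<open>I\<close> never gets ahead of another code of the same trace. If
  both counts agree below \<open>n\<close> and \<open>J'\<close> contains \<open>n\<close>, then
  \<open>n\<close> is in \<open>I\<close>, so the common trace forces \<open>n\<close> into
  \<open>J\<close> as well. If \<open>J'\<close> is behind, one step can at most draw level.\<close>

lemma card_jump_set_le:
  assumes "finite J" "J' \<subseteq> I" "jump_set c J' \<inter> I = jump_set c J \<inter> I"
  shows "card (J' \<inter> {..<n}) \<le> card (J \<inter> {..<n})"
proof (induction n)
  case (Suc n)
  have "n \<in> I \<Longrightarrow> (n \<in> jump_set c J' \<longleftrightarrow> n \<in> jump_set c J)" using assms(3) by blast
  then show ?case using Suc assms(2)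
    by (cases "card (J' \<inter> {..<n}) = card (J \<inter> {..<n})")
       (auto simp: card_Int_lessThan_Suc jump_set_def)
qed simp

lemma card_subsets_le:
  assumes "finite I"
  shows "card {J. J \<subseteq> I \<and> card J \<le> D} = binom_le (card I) D"
proof (cases "D < card I")
  case True
  have "{J. J \<subseteq> I \<and> card J \<le> D} = (\<Union>i\<le>D. {J. J \<subseteq> I \<and> card J = i})" by auto
  also have "card \<dots> = (\<Sum>i\<le>D. card {J. J \<subseteq> I \<and> card J = i})"
    by (rule card_UN_disjoint) (use assms in auto)
  finally show ?thesis using True by (simp add: n_subsets[OF assms] binom_le_def)
next
  case False
  then have "{J. J \<subseteq> I \<and> card J \<le> D} = Pow I"
    using card_mono[OF assms] by (auto intro: order_trans[of _ "card I"])
  then show ?thesis using False assms by (simp add: binom_le_def card_Pow)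
qed

text \<open>The map \<open>?f\<close> is an injection of the finite set \<open>Pow I\<close> into
  itself, hence onto: every trace has exactly one code inside \<open>I\<close>. By
  \<open>card_jump_set_le\<close> this code is smallest among all codes of the trace, so the traces
  correspond to the subsets of \<open>I\<close> with at most \<open>D\<close> elements, whatever
  \<open>c\<close> is.\<close>

lemma maximum_sys_jump_set:
  "maximum_sys D UNIV (jump_set c ` {J. finite J \<and> card J \<le> D})"
  unfolding maximum_sys_def
proof (intro conjI allI impI)
  fix I :: "nat set" assume "finite I \<and> I \<subseteq> UNIV"
  then have fin: "finite I" by simp
  let ?f = "\<lambda>J. jump_set c J \<inter> I"
  have "restrict_sys (jump_set c ` {J. finite J \<and> card J \<le> D}) I = ?f ` {J. J \<subseteq> I \<and> card J \<le> D}"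
  proof
    show "?f ` {J. J \<subseteq> I \<and> card J \<le> D} \<subseteq> restrict_sys (jump_set c ` {J. finite J \<and> card J \<le> D}) I"
      using fin by (auto simp: restrict_sys_def dest: finite_subset)
    have surj: "?f ` Pow I = Pow I"
      by (rule endo_inj_surj) (use fin inj_on_jump_set in auto)
    show "restrict_sys (jump_set c ` {J. finite J \<and> card J \<le> D}) I \<subseteq> ?f ` {J. J \<subseteq> I \<and> card J \<le> D}"
    proof
      fix S assume "S \<in> restrict_sys (jump_set c ` {J. finite J \<and> card J \<le> D}) I"
      then obtain J where J: "finite J" "card J \<le> D" "S = ?f J" by (auto simp: restrict_sys_def)
      have "S \<in> ?f ` Pow I" unfolding surj using J by auto
      then obtain J' where J': "J' \<subseteq> I" "S = ?f J'" by auto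
      have finJ': "finite J'" using J'(1) fin finite_subset by blast
      \<comment> \<open>Beyond \<open>n\<close> both sets are exhausted, so the comparison of
        initial counts becomes one of cardinalities.\<close>
      obtain n where n: "J \<union> J' \<subseteq> {..<n}"
        using finite_nat_iff_bounded[of "J \<union> J'"] J(1) finJ' by auto
      have "card J' \<le> card J"
        using card_jump_set_le[OF J(1) J'(1), of c n] J(3) J'(2) n
        by (metis Int_absorb2 le_sup_iff)
      then show "S \<in> ?f ` {J. J \<subseteq> I \<and> card J \<le> D}" using J J' by auto
    qed
  qed
  moreover have "inj_on ?f {J. J \<subseteq> I \<and> card J \<le> D}"
    by (rule inj_on_subset[OF inj_on_jump_set]) auto
  ultimately show "card (restrict_sys (jump_set c ` {J. finite J \<and> card J \<le> D}) I) = binom_le (card I) D"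
    by (simp add: card_image card_subsets_le[OF fin])
qed simp

lemma restrict_sys_eq_image: "restrict_sys \<C> A = (\<lambda>C. C \<inter> A) ` \<C>"
  by (auto simp: restrict_sys_def)

lemma maximum_sys_image:
  assumes max: "maximum_sys D UNIV \<C>" and inj: "inj b"
  shows "maximum_sys D (range b) ((`) b ` \<C>)"
  unfolding maximum_sys_def
proof (intro conjI allI impI)
  fix A assume A: "finite A \<and> A \<subseteq> range b"
  define I where "I = b -` A"
  have AI: "A = b ` I" using A by (auto simp: I_def)
  have fin: "finite I" using A inj by (simp add: I_def finite_vimageI)
  have "restrict_sys ((`) b ` \<C>) A = (`) b ` restrict_sys \<C> I"
    by (simp add: restrict_sys_eq_image AI image_image image_Int[OF inj])
  moreover have "inj_on ((`) b) (restrict_sys \<C> I)"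
    by (rule inj_onI) (use inj in \<open>simp add: inj_image_eq_iff\<close>)
  ultimately have "card (restrict_sys ((`) b ` \<C>) A) = card (restrict_sys \<C> I)"
    by (simp add: card_image)
  also have "\<dots> = binom_le (card I) D" using max fin by (simp add: maximum_sys_def)
  also have "card I = card A" using inj by (simp add: AI card_image inj_on_subset)
  finally show "card (restrict_sys ((`) b ` \<C>) A) = binom_le (card A) D" .
qed auto

text \<open>The target shows what is left of the current run, followed by everything after that run.
  A letter without a jump uses up one copy of \<open>c r\<close>; a jump skips the remaining copies,
  takes the separator \<open>\<not> c r\<close> and enters a fresh run of \<open>m\<close> copies.
  As \<open>k \<le> m\<close>, no run is exhausted by the \<open>k\<close> letters still to
  come.\<close>

lemma subseq_block_word_jump_set:
  assumes "finite J" "card J \<le> D"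
  shows "k \<le> m \<Longrightarrow> r = card (J \<inter> {..<a}) \<Longrightarrow>
    subseq (map (\<lambda>i. i \<in> jump_set c J) [a..<a + k])
      (replicate k (c r) @ drop m (block_word m (map c [r..<D]) (c D)))"
proof (induction k arbitrary: a r)
  case 0
  then show ?case by simp
next
  case (Suc k)
  have upt: "[a..<a + Suc k] = a # [Suc a..<Suc a + k]"
    by (simp add: upt_conv_Cons)
  show ?case
  proof (cases "a \<in> J")
    case False
    then have "subseq (map (\<lambda>i. i \<in> jump_set c J) [Suc a..<Suc a + k])
      (replicate k (c r) @ drop m (block_word m (map c [r..<D]) (c D)))"
      using Suc.IH[of r "Suc a"] Suc.prems by (simp add: card_Int_lessThan_Suc del: upt_Suc)
    moreover have "(a \<in> jump_set c J) = c r" using False Suc.prems by (simp add: jump_set_def)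
    ultimately show ?thesis unfolding upt by (simp del: upt_Suc)
  next
    case True
    \<comment> \<open>The jump at \<open>a\<close> has number \<open>r + 1\<close> and there are at
      most \<open>D\<close> jumps, so the separator \<open>\<not> c r\<close> exists.\<close>
    have r: "Suc r = card (J \<inter> {..<Suc a})" using True Suc.prems by (simp add: card_Int_lessThan_Suc)
    also have "\<dots> \<le> D" using card_mono[of J "J \<inter> {..<Suc a}"] assms by auto
    finally have rD: "r < D" by simp
    then have "[r..<D] = r # [Suc r..<D]" by (simp add: upt_conv_Cons)
    then have d: "drop m (block_word m (map c [r..<D]) (c D))
        = (\<not> c r) # block_word m (map c [Suc r..<D]) (c D)" by simp
    define w where "w = map (\<lambda>i. i \<in> jump_set c J) [Suc a..<Suc a + k]"
    define B where "B = block_word m (map c [Suc r..<D]) (c D)"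
    \<comment> \<open>A full run follows the separator, be it an inner run or the last one.\<close>
    have B: "B = replicate m (c (Suc r)) @ drop m B"
    proof (cases "Suc r < D")
      case True
      then have "[Suc r..<D] = Suc r # [Suc (Suc r)..<D]" by (simp add: upt_conv_Cons)
      then show ?thesis by (simp add: B_def)
    next
      case False
      then have "D = Suc r" using rD by simp
      then show ?thesis by (simp add: B_def)
    qed
    have "subseq w (replicate k (c (Suc r)) @ drop m B)"
      unfolding w_def B_def using Suc.IH[OF _ r] Suc.prems by simp
    moreover have "subseq (replicate k (c (Suc r))) (replicate m (c (Suc r)))"
      using subseq_block_word_mono[of k m "[]"] Suc.prems by simp
    ultimately have "subseq w B"
      by (metis B list_emb_append_mono subseq_order.order_refl subseq_order.order_trans)
    then have "subseq ((\<not> c r) # w) (replicate (Suc k) (c r) @ (\<not> c r) # B)"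
      by (intro subseq_drop_many) simp
    moreover have "(a \<in> jump_set c J) = (\<not> c r)" using True Suc.prems by (simp add: jump_set_def)
    ultimately show ?thesis unfolding upt d B_def[symmetric] w_def by (simp del: upt_Suc)
  qed
qed

lemma jump_set_subseq_block_word:
  assumes "finite J" "card J \<le> D"
  shows "subseq (map (\<lambda>i. i \<in> jump_set c J) [0..<n]) (block_word n (map c [0..<D]) (c D))"
proof -
  have "block_word n (map c [0..<D]) (c D)
      = replicate n (c 0) @ drop n (block_word n (map c [0..<D]) (c D))"
    by (cases D) (simp_all add: upt_conv_Cons del: upt_Suc)
  then show ?thesis
    using subseq_block_word_jump_set[OF assms order_refl, where a = 0 and r = 0 and k = n and c = c] by simp
qed

section \<open>Definable predicates and compactness\<close>

lemma val_cong: "(\<And>v. v \<in> fv_tm t \<Longrightarrow> e v = e' v) \<Longrightarrow> val M e t = val M e' t"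
proof (induction t)
  case (App f ts)
  then have "map (val M e) ts = map (val M e') ts" by (auto intro!: map_cong)
  then show ?case by (simp only: val.simps)
qed simp

lemma sat_cong: "(\<And>v. v \<in> fv \<psi> \<Longrightarrow> e v = e' v) \<Longrightarrow> sat M e \<psi> = sat M e' \<psi>"
proof (induction \<psi> arbitrary: e e')
  case (Eq s t)
  then have "val M e s = val M e' s" "val M e t = val M e' t" by (auto intro!: val_cong)
  then show ?case by simp
next
  case (Rel r ts)
  then have "map (val M e) ts = map (val M e') ts" by (auto intro!: map_cong val_cong)
  then show ?case by (simp only: sat.simps)
next
  case (Neg \<psi>)
  have "sat M e \<psi> = sat M e' \<psi>" by (rule Neg.IH) (use Neg.prems in simp)
  then show ?case by simp
next
  case (Conj \<psi> \<chi>)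
  have "sat M e \<psi> = sat M e' \<psi>" by (rule Conj.IH(1)) (use Conj.prems in simp)
  moreover have "sat M e \<chi> = sat M e' \<chi>" by (rule Conj.IH(2)) (use Conj.prems in simp)
  ultimately  show ?case by simp
next
  case (Exists v \<psi>)
  have "sat M (e(v := c)) \<psi> = sat M (e'(v := c)) \<psi>" for c
    by (rule Exists.IH) (use Exists.prems in auto)
  then show ?case by simp
qed

section \<open>Renaming variables; definable predicates\<close>

primrec rename_tm :: "(nat \<Rightarrow> nat) \<Rightarrow> 'f tm \<Rightarrow> 'f tm" where
  "rename_tm \<pi> (Var v) = Var (\<pi> v)"
| "rename_tm \<pi> (App f ts) = App f (map (rename_tm \<pi>) ts)"

text \<open>Bound variables are renamed too. For injective \<open>\<pi>\<close> nothing is captured,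
  and renaming amounts to composing the valuation with \<open>\<pi>\<close>.\<close>

primrec rename :: "(nat \<Rightarrow> nat) \<Rightarrow> ('f, 'r) fm \<Rightarrow> ('f, 'r) fm" where
  "rename \<pi> (Eq s t) = Eq (rename_tm \<pi> s) (rename_tm \<pi> t)"
| "rename \<pi> (Rel r ts) = Rel r (map (rename_tm \<pi>) ts)"
| "rename \<pi> (Neg \<psi>) = Neg (rename \<pi> \<psi>)"
| "rename \<pi> (Conj \<psi> \<chi>) = Conj (rename \<pi> \<psi>) (rename \<pi> \<chi>)"
| "rename \<pi> (Exists v \<psi>) = Exists (\<pi> v) (rename \<pi> \<psi>)"

lemma fv_rename_tm: "fv_tm (rename_tm \<pi> t) = \<pi> ` fv_tm t"
  by (induction t) auto

lemma wf_rename_tm: "wf_tm L t \<Longrightarrow> wf_tm L (rename_tm \<pi> t)"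
  by (induction t) (auto simp: list_all_iff)

lemma val_rename_tm: "val M e (rename_tm \<pi> t) = val M (e \<circ> \<pi>) t"
proof (induction t)
  case (App f ts)
  then have "map (val M e \<circ> rename_tm \<pi>) ts = map (val M (e \<circ> \<pi>)) ts" by (simp add: comp_def)
  then show ?case by (simp only: rename_tm.simps val.simps map_map)
qed simp

lemma fv_rename: "inj \<pi> \<Longrightarrow> fv (rename \<pi> \<psi>) = \<pi> ` fv \<psi>"
  by (induction \<psi>) (auto simp: fv_rename_tm inj_def)

lemma wf_rename: "wf_fm L \<psi> \<Longrightarrow> wf_fm L (rename \<pi> \<psi>)"
  by (induction \<psi>) (auto simp: wf_rename_tm)

lemma sat_rename:
  assumes "inj \<pi>"
  shows "sat M e (rename \<pi> \<psi>) = sat M (e \<circ> \<pi>) \<psi>"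
proof (induction \<psi> arbitrary: e)
  case (Rel r ts)
  have "map (val M e \<circ> rename_tm \<pi>) ts = map (val M (e \<circ> \<pi>)) ts" by (simp add: val_rename_tm)
  then show ?case by (simp only: rename.simps sat.simps map_map)
next
  case (Exists v \<psi>)
  have "e(\<pi> v := c) \<circ> \<pi> = (e \<circ> \<pi>)(v := c)" for c
    using assms by (auto simp: fun_eq_iff inj_eq)
  then show ?case by (simp only: rename.simps sat.simps Exists)
qed (simp_all add: val_rename_tm)

text \<open>Predicates on valuations take the place of formulas, so that conditions are combined by
  closure properties instead of explicit syntax; \<open>V\<close> bounds the variables they depend
  on.\<close>

definition definable ::
    "('f, 'r) language \<Rightarrow> ('f, 'r, 'm) struct \<Rightarrow> nat set \<Rightarrow> ((nat \<Rightarrow> 'm) \<Rightarrow> bool) \<Rightarrow> bool" where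
  "definable L M V P \<longleftrightarrow> (\<exists>\<psi>\<in>formulas L. fv \<psi> \<subseteq> V \<and> P = (\<lambda>e. sat M e \<psi>))"

lemma definable_sat: "\<psi> \<in> formulas L \<Longrightarrow> fv \<psi> \<subseteq> V \<Longrightarrow> definable L M V (\<lambda>e. sat M e \<psi>)"
  by (auto simp: definable_def)

lemma definable_cong:
  "definable L M V P \<Longrightarrow> (\<And>v. v \<in> V \<Longrightarrow> e v = e' v) \<Longrightarrow> P e = P e'"
  by (auto simp: definable_def subset_iff intro!: sat_cong)

lemma definable_mono: "definable L M V P \<Longrightarrow> V \<subseteq> W \<Longrightarrow> definable L M W P"
  by (auto simp: definable_def)

lemma definable_Not: "definable L M V P \<Longrightarrow> definable L M V (\<lambda>e. \<not> P e)"
  unfolding definable_def formulas_def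
  by (elim bexE, rule_tac x = "Neg \<psi>" in bexI) auto

lemma definable_Conj:
  "definable L M V P \<Longrightarrow> definable L M V Q \<Longrightarrow> definable L M V (\<lambda>e. P e \<and> Q e)"
  unfolding definable_def formulas_def
  by (elim bexE, rule_tac x = "Conj \<psi> \<psi>'" in bexI) auto

lemma definable_eq_const:
  "definable L M V P \<Longrightarrow> definable L M V (\<lambda>e. P e = b)"
  using definable_Not by (cases b) auto

lemma definable_Ex:
  "definable L M V P \<Longrightarrow> definable L M (V - {v}) (\<lambda>e. \<exists>c. P (e(v := c)))"
  unfolding definable_def formulas_def
  by (elim bexE, rule_tac x = "Exists v \<psi>" in bexI) auto

lemma definable_True: "definable L M V (\<lambda>e. True)"
  unfolding definable_def formulas_def
  \<comment> \<open>The quantifier makes this a sentence, as is required when \<open>V\<close> is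
    empty.\<close>
  by (rule bexI[of _ "Exists 0 (Eq (Var 0) (Var 0))"]) auto

lemma definable_Ball:
  "finite S \<Longrightarrow> (\<And>s. s \<in> S \<Longrightarrow> definable L M V (P s)) \<Longrightarrow> definable L M V (\<lambda>e. \<forall>s\<in>S. P s e)"
  by (induction S rule: finite_induct) (auto intro: definable_True definable_Conj)

lemma definable_Ex_finite:
  assumes "finite W" "definable L M V P"
  shows "definable L M (V - W) (\<lambda>e. \<exists>e'. (\<forall>v. v \<notin> W \<longrightarrow> e' v = e v) \<and> P e')"
  using assms
proof (induction W rule: finite_induct)
  case empty
  have "(\<exists>e'. (\<forall>v. v \<notin> {} \<longrightarrow> e' v = e v) \<and> P e') = P e" for e :: "nat \<Rightarrow> 'c"
    by (auto simp: fun_eq_iff[symmetric])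
  then show ?case using empty by simp
next
  case (insert w W)
  have "(\<exists>e'. (\<forall>v. v \<notin> insert w W \<longrightarrow> e' v = e v) \<and> P e')
      = (\<exists>c e'. (\<forall>v. v \<notin> W \<longrightarrow> e' v = (e(w := c)) v) \<and> P e')" for e :: "nat \<Rightarrow> 'c"
  proof
    assume "\<exists>e'. (\<forall>v. v \<notin> insert w W \<longrightarrow> e' v = e v) \<and> P e'"
    then obtain e' where "\<And>v. v \<notin> insert w W \<Longrightarrow> e' v = e v" "P e'" by blast
    then have "(\<forall>v. v \<notin> W \<longrightarrow> e' v = (e(w := e' w)) v) \<and> P e'" by auto
    then show "\<exists>c e'. (\<forall>v. v \<notin> W \<longrightarrow> e' v = (e(w := c)) v) \<and> P e'" by blast
  next
    assume "\<exists>c e'. (\<forall>v. v \<notin> W \<longrightarrow> e' v = (e(w := c)) v) \<and> P e'"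
    then obtain c e' where "\<forall>v. v \<notin> W \<longrightarrow> e' v = (e(w := c)) v" "P e'" by blast
    then show "\<exists>e'. (\<forall>v. v \<notin> insert w W \<longrightarrow> e' v = e v) \<and> P e'"
      by (intro exI[of _ e']) simp
  qed
  moreover have "V - insert w W = V - W - {w}" by auto
  ultimately show ?case
    using definable_Ex[OF insert.IH[OF insert.prems], of w] by simp
qed

text \<open>\<open>\<sigma>\<close> is injective on \<open>V\<close> only, whereas renaming acts on
  bound variables as well. The extension \<open>\<pi>\<close> shifts all variables outside
  \<open>V\<close> past the image of \<open>V\<close> and is injective everywhere.\<close>

lemma definable_comp:
  assumes "definable L M V P" "finite V" "inj_on \<sigma> V"
  shows "definable L M (\<sigma> ` V) (\<lambda>e. P (e \<circ> \<sigma>))"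
proof -
  obtain B where B: "\<And>v. v \<in> V \<Longrightarrow> \<sigma> v < B"
    using assms(2) finite_nat_iff_bounded[of "\<sigma> ` V"] by auto
  define \<pi> where "\<pi> = (\<lambda>v. if v \<in> V then \<sigma> v else v + B)"
  have inj: "inj \<pi>"
  proof (rule injI)
    fix v w assume eq: "\<pi> v = \<pi> w"
    show "v = w"
      using eq assms(3) B[of v] B[of w] by (auto simp: \<pi>_def inj_on_def split: if_splits)
  qed
  obtain \<psi> where \<psi>: "\<psi> \<in> formulas L" "fv \<psi> \<subseteq> V" "P = (\<lambda>e. sat M e \<psi>)"
    using assms(1) by (auto simp: definable_def)
  have "sat M (e \<circ> \<sigma>) \<psi> = sat M e (rename \<pi> \<psi>)" for e
    unfolding sat_rename[OF inj] by (rule sat_cong) (use \<psi>(2) in \<open>auto simp: \<pi>_def\<close>)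
  moreover have "rename \<pi> \<psi> \<in> formulas L"
    using \<psi>(1) by (simp add: formulas_def wf_rename)
  moreover have "fv (rename \<pi> \<psi>) \<subseteq> \<sigma> ` V"
    unfolding fv_rename[OF inj] using \<psi>(2) by (auto simp: \<pi>_def)
  ultimately show ?thesis unfolding definable_def \<psi>(3) by auto
qed

text \<open>In \<^const>\<open>saturated\<close> the free variable is \<open>0\<close>, so the variables \<open>0\<close> and \<open>n\<close> are
  swapped.\<close>

lemma saturated_realise:
  fixes M :: "('f, 'r, 'm) struct"
  assumes sat: "saturated L M" and inf: "infinite (UNIV :: 'm set)"
    and def: "\<And>P. P \<in> Q \<Longrightarrow> definable L M {..n} P"
    and fin: "\<And>q. q \<subseteq> Q \<Longrightarrow> finite q \<Longrightarrow> \<exists>c. \<forall>P\<in>q. P (e(n := c))"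
  shows "\<exists>c. \<forall>P\<in>Q. P (e(n := c))"
proof -
  define \<tau> where "\<tau> = id(0 := n, n := 0 :: nat)"
  have inj\<tau>: "inj \<tau>" by (auto simp: \<tau>_def inj_def)
  have upd: "((e \<circ> \<tau>)(0 := c)) \<circ> \<tau> = e(n := c)" for c
    by (auto simp: \<tau>_def fun_eq_iff)
  have "definable L M (\<tau> ` {..n}) (\<lambda>e. P (e \<circ> \<tau>))" if "P \<in> Q" for P
    by (rule definable_comp[OF def[OF that]]) (use inj\<tau> inj_on_subset in auto)
  then have "\<forall>P\<in>Q. \<exists>\<psi>. \<psi> \<in> formulas L \<and> fv \<psi> \<subseteq> \<tau> ` {..n} \<and> (\<lambda>e. P (e \<circ> \<tau>)) = (\<lambda>e. sat M e \<psi>)"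
    unfolding definable_def by blast
  then obtain \<Psi> where \<Psi>: "\<And>P. P \<in> Q \<Longrightarrow> \<Psi> P \<in> formulas L \<and> fv (\<Psi> P) \<subseteq> \<tau> ` {..n}
      \<and> (\<lambda>e. P (e \<circ> \<tau>)) = (\<lambda>e. sat M e (\<Psi> P))"
    by metis
  have P_iff: "P (e(n := c)) \<longleftrightarrow> sat M ((e \<circ> \<tau>)(0 := c)) (\<Psi> P)" if "P \<in> Q" for P c
    using fun_cong[OF conjunct2[OF conjunct2[OF \<Psi>[OF that]]], of "(e \<circ> \<tau>)(0 := c)"]
    unfolding upd .
  define p where "p = (\<lambda>P. (\<Psi> P, e \<circ> \<tau>)) ` Q"
  \<comment> \<open>Besides the value sought, only the values of \<open>e\<close> below
    \<open>n\<close> occur as parameters; they are finitely many.\<close>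
  have small: "e ` {..<n} \<prec> (UNIV :: 'm set)"
    using inf by (intro finite_lesspoll_infinite) auto
  have "p \<subseteq> {(\<psi>, e'). \<psi> \<in> formulas L \<and> (\<forall>v \<in> fv \<psi> - {0}. e' v \<in> e ` {..<n})}"
  proof
    fix z assume "z \<in> p"
    then obtain P where P: "P \<in> Q" "z = (\<Psi> P, e \<circ> \<tau>)" by (auto simp: p_def)
    have "(e \<circ> \<tau>) v \<in> e ` {..<n}" if "v \<in> fv (\<Psi> P) - {0}" for v
    proof -
      have "v \<in> \<tau> ` {..n}" "v \<noteq> 0" using \<Psi>[OF P(1)] that by auto
      then have "\<tau> v < n" by (auto simp: \<tau>_def split: if_splits)
      then show ?thesis by simp
    qed
    then show "z \<in> {(\<psi>, e'). \<psi> \<in> formulas L \<and> (\<forall>v \<in> fv \<psi> - {0}. e' v \<in> e ` {..<n})}"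
      using P \<Psi>[OF P(1)] by simp
  qed
  moreover have "\<exists>c. \<forall>(\<psi>, e')\<in>q. sat M (e'(0 := c)) \<psi>" if q: "q \<subseteq> p" "finite q" for q
  proof -
    obtain q' where q': "q' \<subseteq> Q" "finite q'" "q = (\<lambda>P. (\<Psi> P, e \<circ> \<tau>)) ` q'"
      using finite_subset_image[OF q(2) q(1)[unfolded p_def]] by blast
    obtain c where "\<forall>P\<in>q'. P (e(n := c))" using fin q' by blast
    then have "\<forall>(\<psi>, e')\<in>q. sat M (e'(0 := c)) \<psi>" using P_iff q' by auto
    then show ?thesis ..
  qed
  ultimately have "\<exists>c. \<forall>(\<psi>, e')\<in>p. sat M (e'(0 := c)) \<psi>"
    using sat[unfolded saturated_def, rule_format, of "e ` {..<n}" p] small by simp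
  then obtain c where "\<forall>(\<psi>, e')\<in>p. sat M (e'(0 := c)) \<psi>" ..
  then have "\<forall>P\<in>Q. P (e(n := c))" using P_iff by (auto simp: p_def)
  then show ?thesis ..
qed

text \<open>Values are chosen one variable at a time, \<open>ok n e\<close> saying that those below
  \<open>n\<close> keep every finite part of \<open>\<Gamma>\<close> satisfiable. Each step realises
  a type in one variable over finitely many parameters. The diagonal valuation works because every
  member of \<open>\<Gamma>\<close> depends on finitely many variables.\<close>

lemma saturated_compact:
  fixes M :: "('f, 'r, 'm) struct"
  assumes sat: "saturated L M" and inf: "infinite (UNIV :: 'm set)"
    and def: "\<And>P. P \<in> \<Gamma> \<Longrightarrow> \<exists>V. finite V \<and> definable L M V P"
    and fin: "\<And>q. q \<subseteq> \<Gamma> \<Longrightarrow> finite q \<Longrightarrow> \<exists>e. \<forall>P\<in>q. P e"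
  shows "\<exists>e. \<forall>P\<in>\<Gamma>. P e"
proof -
  define ok where "ok n e \<longleftrightarrow> (\<forall>q \<subseteq> \<Gamma>. finite q \<longrightarrow> (\<exists>e'. (\<forall>v<n. e' v = e v) \<and> (\<forall>P\<in>q. P e')))"
    for n and e :: "nat \<Rightarrow> 'm"
  have "\<exists>e. ok 0 e" using fin by (auto simp: ok_def)
  moreover have "\<exists>e'. ok (Suc n) e' \<and> (\<forall>v<n. e' v = e v)" if ok: "ok n e" for n e
  proof -
    define \<chi> where "\<chi> q = (\<lambda>e :: nat \<Rightarrow> 'm. \<exists>e'. (\<forall>v<Suc n. e' v = e v) \<and> (\<forall>P\<in>q. P e'))" for q
    have "\<exists>c. \<forall>P\<in>\<chi> ` {q. q \<subseteq> \<Gamma> \<and> finite q}. P (e(n := c))"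
    proof (rule saturated_realise[OF sat inf])
      fix R assume "R \<in> \<chi> ` {q. q \<subseteq> \<Gamma> \<and> finite q}"
      then obtain q where q: "q \<subseteq> \<Gamma>" "finite q" "R = \<chi> q" by auto
      have "\<forall>P\<in>q. \<exists>V. finite V \<and> definable L M V P" using def q by blast
      then obtain V where V: "\<And>P. P \<in> q \<Longrightarrow> finite (V P) \<and> definable L M (V P) P" by metis
      define U where "U = (\<Union>P\<in>q. V P)"
      have "finite U" using q V by (simp add: U_def)
      have conj: "definable L M U (\<lambda>e. \<forall>P\<in>q. P e)"
        by (rule definable_Ball) (use q V in \<open>auto simp: U_def intro: definable_mono\<close>)
      \<comment> \<open>In \<open>\<chi> q\<close> all variables beyond \<open>n\<close> are
        quantified, but only the finitely many in \<open>U\<close> affect the members of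
        \<open>q\<close>.\<close>
      have "definable L M (U - (U - {..n}))
          (\<lambda>e. \<exists>e'. (\<forall>v. v \<notin> U - {..n} \<longrightarrow> e' v = e v) \<and> (\<forall>P\<in>q. P e'))"
        by (rule definable_Ex_finite[OF _ conj]) (use \<open>finite U\<close> in simp)
      moreover have "(\<lambda>e. \<exists>e'. (\<forall>v. v \<notin> U - {..n} \<longrightarrow> e' v = e v) \<and> (\<forall>P\<in>q. P e')) = \<chi> q"
      proof (intro ext iffI)
        fix e :: "nat \<Rightarrow> 'm"
        assume "\<exists>e'. (\<forall>v. v \<notin> U - {..n} \<longrightarrow> e' v = e v) \<and> (\<forall>P\<in>q. P e')"
        then show "\<chi> q e" unfolding \<chi>_def by (metis DiffD2 atMost_iff less_Suc_eq_le)
      next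
        fix e :: "nat \<Rightarrow> 'm"
        assume "\<chi> q e"
        then obtain e' where e': "\<forall>v<Suc n. e' v = e v" "\<forall>P\<in>q. P e'" by (auto simp: \<chi>_def)
        define e'' where "e'' v = (if v \<in> U then e' v else e v)" for v
        have "(\<forall>P\<in>q. P e'') = (\<forall>P\<in>q. P e')"
          by (rule definable_cong[OF conj]) (simp add: e''_def)
        moreover have "\<forall>v. v \<notin> U - {..n} \<longrightarrow> e'' v = e v"
          using e'(1) by (auto simp: e''_def less_Suc_eq_le)
        ultimately show "\<exists>e'. (\<forall>v. v \<notin> U - {..n} \<longrightarrow> e' v = e v) \<and> (\<forall>P\<in>q. P e')"
          using e'(2) by blast
      qed
      ultimately show "definable L M {..n} R"
        using q(3) by (auto intro: definable_mono)
    next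
      fix Q assume Q: "Q \<subseteq> \<chi> ` {q. q \<subseteq> \<Gamma> \<and> finite q}" "finite Q"
      then obtain F where F: "F \<subseteq> {q. q \<subseteq> \<Gamma> \<and> finite q}" "finite F" "Q = \<chi> ` F"
        using finite_subset_image[OF Q(2,1)] by blast
      \<comment> \<open>Finitely many conditions \<open>\<chi> q\<close> follow from the one for the
        union, which is again a finite part of \<open>\<Gamma>\<close>.\<close>
      have "\<Union>F \<subseteq> \<Gamma>" using F(1) by blast
      moreover have "finite (\<Union>F)"
        by (rule finite_Union[OF F(2)]) (use F(1) in blast)
      ultimately obtain e' where e': "\<forall>v<n. e' v = e v" "\<forall>P\<in>\<Union>F. P e'"
        using ok unfolding ok_def by meson
      have "\<chi> q (e(n := e' n))" if "q \<in> F" for q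
        unfolding \<chi>_def using e' that by (intro exI[of _ e']) (auto simp: less_Suc_eq)
      then show "\<exists>c. \<forall>P\<in>Q. P (e(n := c))" using F(3) by blast
    qed
    then obtain c where c: "\<And>q. q \<subseteq> \<Gamma> \<Longrightarrow> finite q \<Longrightarrow> \<chi> q (e(n := c))" by blast
    have "ok (Suc n) (e(n := c))" using c by (simp add: ok_def \<chi>_def)
    then show ?thesis by (intro exI[of _ "e(n := c)"]) simp
  qed
  ultimately have "\<exists>E. \<forall>n. ok n (E n) \<and> (\<forall>v<n. E (Suc n) v = E n v)"
    by (rule dependent_nat_choice)
  then obtain E where E: "\<And>n. ok n (E n)" "\<And>n v. v < n \<Longrightarrow> E (Suc n) v = E n v"
    by blast
  \<comment> \<open>Later stages keep the value of \<open>v\<close> that was fixed at stage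
    \<open>Suc v\<close>.\<close>
  have stable: "E (Suc v + d) v = E (Suc v) v" for v d
    by (induction d) (simp_all add: E(2))
  have "P (\<lambda>v. E (Suc v) v)" if P: "P \<in> \<Gamma>" for P
  proof -
    obtain V where V: "finite V" "definable L M V P" using def[OF P] by blast
    obtain n where n: "V \<subseteq> {..<n}" using V(1) finite_nat_iff_bounded by blast
    have "{P} \<subseteq> \<Gamma>" "finite {P}" using P by auto
    then obtain e' where e': "\<forall>v<n. e' v = E n v" "P e'"
      using E(1)[of n] unfolding ok_def by (metis singletonI)
    have "P e' = P (\<lambda>v. E (Suc v) v)"
    proof (rule definable_cong[OF V(2)])
      fix v assume "v \<in> V"
      then have "v < n" using n by auto
      then obtain d where "n = Suc v + d" using less_iff_Suc_add by (metis add_Suc_shift add_Suc)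
      then show "e' v = E (Suc v) v" using e'(1) stable[of v d] \<open>v < n\<close> by simp
    qed
    then show ?thesis using e'(2) by simp
  qed
  then show ?thesis by blast
qed

section \<open>Indiscernible sequences and types\<close>

lemma assign_map:
  assumes "length as = length vs" "v \<in> set vs"
  shows "assign vs (map f as) v = f (assign vs as v)"
proof -
  obtain a where "map_of (zip vs as) v = Some a"
    using assms by (metis map_of_zip_is_Some)
  then show ?thesis by (simp add: assign_def zip_map2 map_of_map)
qed

lemma assign_nth:
  "distinct vs \<Longrightarrow> length as = length vs \<Longrightarrow> i < length vs \<Longrightarrow> assign vs as (vs ! i) = as ! i"
  by (simp add: assign_def map_of_zip_nth)

lemma assign_image:
  assumes "distinct vs" "length as = length vs"
  shows "assign vs as ` set vs = set as"
proof -
  have "map (assign vs as) vs = as"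
    using assms by (intro nth_equalityI) (simp_all add: assign_nth)
  then show ?thesis by (metis set_map)
qed

lemma inj_on_assign:
  assumes "distinct vs" "length as = length vs" "distinct as"
  shows "inj_on (assign vs as) (set vs)"
  using assms by (auto simp: inj_on_def in_set_conv_nth assign_nth nth_eq_iff_index_eq)

lemma assign_upt: "length as = n \<Longrightarrow> v < n \<Longrightarrow> assign [0..<n] as v = as ! v"
  using assign_nth[of "[0..<n]" as v] by simp

text \<open>A sequence of \<open>k\<close>-tuples is coded by the valuation sending the variable \<open>i * k + j\<close> to the
  \<open>j\<close>-th entry of the \<open>i\<close>-th tuple.\<close>

definition block :: "nat \<Rightarrow> nat \<Rightarrow> (nat \<Rightarrow> 'm) \<Rightarrow> 'm list" where
  "block k i e = map (\<lambda>j. e (i * k + j)) [0..<k]"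

definition unblock :: "nat \<Rightarrow> (nat \<Rightarrow> 'm list) \<Rightarrow> nat \<Rightarrow> 'm" where
  "unblock k a v = a (v div k) ! (v mod k)"

lemma length_block [simp]: "length (block k i e) = k"
  by (simp add: block_def)

lemma block_unblock: "length (a i) = k \<Longrightarrow> block k i (unblock k a) = a i"
  by (rule nth_equalityI) (auto simp: block_def unblock_def)

lemma map_unblock:
  "(\<And>i. i < n \<Longrightarrow> length (a i) = k) \<Longrightarrow> map (unblock k a) [0..<n * k] = concat (map a [0..<n])"
proof (induction n)
  case (Suc n)
  have "[0..<Suc n * k] = [0..<n * k] @ map (\<lambda>j. n * k + j) [0..<k]"
    using upt_add_eq_append[of 0 "n * k" k] map_add_upt[of "n * k" k] by (simp add: add.commute)
  moreover have "map (\<lambda>j. unblock k a (n * k + j)) [0..<k] = a n"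
    using block_unblock[of a n k] Suc.prems by (simp add: block_def)
  ultimately show ?case using Suc by (simp add: comp_def)
qed simp

text \<open>The variables \<open>vs\<close> of the definition are arbitrary. Renaming them to an
  initial segment of the numbers turns indiscernibility into a statement about definable predicates
  of coded sequences.\<close>

lemma indiscernible_iff:
  assumes k: "0 < k"
  shows "indiscernible L M k bs \<longleftrightarrow> set bs \<subseteq> tuples k \<and>
    (\<forall>is js P. sorted_wrt (<) is \<and> set is \<subseteq> {..<length bs} \<and>
        sorted_wrt (<) js \<and> set js \<subseteq> {..<length bs} \<and>
        length js = length is \<and> definable L M {..<length is * k} P \<longrightarrow>
      P (unblock k (\<lambda>i. bs ! (is ! i))) = P (unblock k (\<lambda>j. bs ! (js ! j))))"
    (is "_ \<longleftrightarrow> _ \<and> ?inv")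
proof (cases "set bs \<subseteq> tuples k")
  case True
  have conc: "concat (map ((!) bs) is) = map (unblock k (\<lambda>i. bs ! (is ! i))) [0..<length is * k]"
    if "set is \<subseteq> {..<length bs}" for "is"
  proof -
    have "length (bs ! (is ! i)) = k" if "i < length is" for i
      using True that \<open>set is \<subseteq> {..<length bs}\<close> nth_mem[of i "is"]
      by (auto simp: tuples_def subset_iff)
    then have "map (unblock k (\<lambda>i. bs ! (is ! i))) [0..<length is * k]
        = concat (map (\<lambda>i. bs ! (is ! i)) [0..<length is])" by (rule map_unblock)
    also have "map (\<lambda>i. bs ! (is ! i)) [0..<length is] = map ((!) bs) is"
      by (rule nth_equalityI) auto
    finally show ?thesis by simp
  qed
  show ?thesis
  proof
    assume ind: "indiscernible L M k bs"
    have ?inv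
    proof (intro allI impI)
      fix "is" js P
      assume asm: "sorted_wrt (<) is \<and> set is \<subseteq> {..<length bs} \<and>
        sorted_wrt (<) js \<and> set js \<subseteq> {..<length bs} \<and>
        length js = length is \<and> definable L M {..<length is * k} P"
      then obtain \<psi> where \<psi>: "\<psi> \<in> formulas L" "fv \<psi> \<subseteq> {..<length is * k}" "P = (\<lambda>e. sat M e \<psi>)"
        by (auto simp: definable_def)
      have P: "P (unblock k (\<lambda>i. bs ! (ls ! i)))
          = sat M (assign [0..<length is * k] (concat (map ((!) bs) ls))) \<psi>"
        if "set ls \<subseteq> {..<length bs}" "length ls = length is" for ls
        unfolding \<psi>(3) conc[OF that(1)]
        by (rule sat_cong) (use \<psi>(2) that(2) in \<open>auto simp: assign_upt subset_iff\<close>)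
      show "P (unblock k (\<lambda>i. bs ! (is ! i))) = P (unblock k (\<lambda>j. bs ! (js ! j)))"
        using ind asm \<psi>(1,2) P[of "is"] P[of js]
        unfolding indiscernible_def by (auto simp: lessThan_atLeast0)
    qed
    then show "set bs \<subseteq> tuples k \<and> ?inv" using True by blast
  next
    assume inv: "set bs \<subseteq> tuples k \<and> ?inv"
    show "indiscernible L M k bs"
      unfolding indiscernible_def
    proof (intro conjI allI ballI impI)
      fix "is" js vs \<psi>
      assume \<psi>: "\<psi> \<in> formulas L"
        and asm: "sorted_wrt (<) is \<and> set is \<subseteq> {..<length bs} \<and>
          sorted_wrt (<) js \<and> set js \<subseteq> {..<length bs} \<and> length js = length is \<and>
          distinct vs \<and> length vs = length is * k \<and> fv \<psi> \<subseteq> set vs"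
      \<comment> \<open>Each variable of \<open>vs\<close> is replaced by its position in the
        list.\<close>
      define \<sigma> where "\<sigma> = assign vs [0..<length is * k]"
      define P where "P = (\<lambda>e. sat M (e \<circ> \<sigma>) \<psi>)"
      have "definable L M (\<sigma> ` set vs) P"
        unfolding P_def
      proof (rule definable_comp[where P = "\<lambda>e. sat M e \<psi>"])
        show "inj_on \<sigma> (set vs)" unfolding \<sigma>_def by (rule inj_on_assign) (use asm in auto)
      qed (use \<psi> asm in \<open>auto intro: definable_sat\<close>)
      moreover have "\<sigma> ` set vs = {..<length is * k}"
        unfolding \<sigma>_def using asm by (subst assign_image) auto
      ultimately have "P (unblock k (\<lambda>i. bs ! (is ! i))) = P (unblock k (\<lambda>j. bs ! (js ! j)))"
        by (intro conjunct2[OF inv, rule_format]) (use asm in simp)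
      moreover have "P (unblock k (\<lambda>i. bs ! (ls ! i)))
          = sat M (assign vs (concat (map ((!) bs) ls))) \<psi>"
        if "set ls \<subseteq> {..<length bs}" "length ls = length is" for ls
        unfolding P_def conc[OF that(1)] that(2)
        by (rule sat_cong) (use asm in \<open>auto simp: \<sigma>_def assign_map subset_iff\<close>)
      ultimately show "sat M (assign vs (concat (map ((!) bs) is))) \<psi>
          \<longleftrightarrow> sat M (assign vs (concat (map ((!) bs) js))) \<psi>"
        using asm by metis
    qed (use inv in blast)
  qed
qed (auto simp: indiscernible_def)

lemma indiscernible_length: "indiscernible L M k bs \<Longrightarrow> i < length bs \<Longrightarrow> length (bs ! i) = k"
  using nth_mem[of i bs] unfolding indiscernible_def tuples_def by blast

section \<open>Realised words and types\<close>

definition realised ::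
    "('f, 'r, 'm) struct \<Rightarrow> ('f, 'r) part_fm \<Rightarrow> bool list \<Rightarrow> (nat \<Rightarrow> 'm list) \<Rightarrow> bool" where
  "realised M \<phi> t a \<longleftrightarrow>
     (\<exists>c\<in>tuples (length (xvars \<phi>)). \<forall>i<length t. holds M \<phi> c (a i) \<longleftrightarrow> t ! i)"

lemma realised_cong:
  "(\<And>i. i < length t \<Longrightarrow> a i = b i) \<Longrightarrow> realised M \<phi> t a = realised M \<phi> t b"
  by (simp add: realised_def)

text \<open>The coded tuples occupy the variables below \<open>n * k\<close>. The next
  \<open>l\<close> variables hold the realising tuple and are then quantified away;
  \<open>idx i\<close> lists the variables to be put into \<open>\<phi>\<close> for the
  \<open>i\<close>-th tuple.\<close>

lemma definable_realised:
  assumes pf: "partitioned_formula L \<phi>"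
  defines "k \<equiv> length (yvars \<phi>)"
  shows "definable L M {..<length t * k} (\<lambda>e. realised M \<phi> t (\<lambda>i. block k i e))"
proof -
  define n where "n = length t"
  define l where "l = length (xvars \<phi>)"
  define vs where "vs = xvars \<phi> @ yvars \<phi>"
  have vs: "distinct vs" "fv (body \<phi>) \<subseteq> set vs" "body \<phi> \<in> formulas L"
    using pf by (auto simp: partitioned_formula_def vs_def)
  define idx where "idx i = map (\<lambda>p. n * k + p) [0..<l] @ map (\<lambda>j. i * k + j) [0..<k]" for i
  define \<sigma> where "\<sigma> i = assign vs (idx i)" for i
  have len: "length (idx i) = length vs" for i by (simp add: idx_def vs_def l_def k_def)
  have bound: "i * k + j < n * k" if "i < n" "j < k" for i j
  proof -
    have "i * k + j < Suc i * k" using that by simp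
    also have "\<dots> \<le> n * k" using that by (intro mult_le_mono1) simp
    finally show ?thesis .
  qed
  have "definable L M {..<n * k + l} (\<lambda>e. sat M (e \<circ> \<sigma> i) (body \<phi>))" if "i < n" for i
  proof (rule definable_mono)
    have "set (map (\<lambda>p. n * k + p) [0..<l]) \<subseteq> {n * k..}" by auto
    moreover have "set (map (\<lambda>j. i * k + j) [0..<k]) \<subseteq> {..<n * k}"
      using bound[OF that] by (auto simp del: image_add_atLeastLessThan)
    ultimately have "set (map (\<lambda>p. n * k + p) [0..<l]) \<inter> set (map (\<lambda>j. i * k + j) [0..<k]) = {}"
      by fastforce
    moreover have "distinct (map (\<lambda>p. m + p) [0..<m'])" for m m' :: nat by (simp add: distinct_map)
    ultimately have "distinct (idx i)" unfolding idx_def distinct_append by blast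
    then show "definable L M (\<sigma> i ` set vs) (\<lambda>e. sat M (e \<circ> \<sigma> i) (body \<phi>))"
      unfolding \<sigma>_def
      by (intro definable_comp[where P = "\<lambda>e. sat M e (body \<phi>)"] definable_sat inj_on_assign vs len) auto
    show "\<sigma> i ` set vs \<subseteq> {..<n * k + l}"
      unfolding \<sigma>_def assign_image[OF vs(1) len]
      using bound[OF that] by (auto simp: idx_def simp del: image_add_atLeastLessThan)
        (meson trans_less_add1)
  qed
  then have "definable L M {..<n * k + l} (\<lambda>e. \<forall>i\<in>{..<n}. sat M (e \<circ> \<sigma> i) (body \<phi>) = t ! i)"
    by (intro definable_Ball definable_eq_const) auto
  then have "definable L M ({..<n * k + l} - {n * k..<n * k + l})
      (\<lambda>e. \<exists>e'. (\<forall>v. v \<notin> {n * k..<n * k + l} \<longrightarrow> e' v = e v) \<and>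
        (\<forall>i\<in>{..<n}. sat M (e' \<circ> \<sigma> i) (body \<phi>) = t ! i))"
    by (rule definable_Ex_finite[rotated]) simp
  moreover have "{..<n * k + l} - {n * k..<n * k + l} = {..<n * k}" by auto
  moreover have "(\<exists>e'. (\<forall>v. v \<notin> {n * k..<n * k + l} \<longrightarrow> e' v = e v) \<and>
        (\<forall>i\<in>{..<n}. sat M (e' \<circ> \<sigma> i) (body \<phi>) = t ! i))
      = realised M \<phi> t (\<lambda>i. block k i e)" for e
  proof -
    have sat_iff: "sat M (e' \<circ> \<sigma> i) (body \<phi>) = holds M \<phi> (map (\<lambda>p. e' (n * k + p)) [0..<l]) (block k i e)"
      if "\<forall>v. v \<notin> {n * k..<n * k + l} \<longrightarrow> e' v = e v" "i < n" for e' i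
    proof -
      have "map e' (idx i) = map (\<lambda>p. e' (n * k + p)) [0..<l] @ block k i e"
        using that(1) bound[OF that(2)] by (simp add: idx_def block_def not_le)
      then have "holds M \<phi> (map (\<lambda>p. e' (n * k + p)) [0..<l]) (block k i e)
          = sat M (assign vs (map e' (idx i))) (body \<phi>)"
        by (simp add: holds_def vs_def)
      also have "\<dots> = sat M (e' \<circ> \<sigma> i) (body \<phi>)"
        by (rule sat_cong) (use vs(2) len in \<open>auto simp: \<sigma>_def assign_map\<close>)
      finally show ?thesis ..
    qed
    show ?thesis
    proof
      assume "\<exists>e'. (\<forall>v. v \<notin> {n * k..<n * k + l} \<longrightarrow> e' v = e v) \<and>
        (\<forall>i\<in>{..<n}. sat M (e' \<circ> \<sigma> i) (body \<phi>) = t ! i)"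
      then obtain e' where e': "\<forall>v. v \<notin> {n * k..<n * k + l} \<longrightarrow> e' v = e v"
        "\<forall>i\<in>{..<n}. sat M (e' \<circ> \<sigma> i) (body \<phi>) = t ! i" by blast
      then show "realised M \<phi> t (\<lambda>i. block k i e)"
        unfolding realised_def n_def[symmetric] l_def[symmetric]
        by (intro bexI[of _ "map (\<lambda>p. e' (n * k + p)) [0..<l]"])
           (auto simp: tuples_def sat_iff)
    next
      assume "realised M \<phi> t (\<lambda>i. block k i e)"
      then obtain c where c: "length c = l" "\<forall>i<n. holds M \<phi> c (block k i e) = t ! i"
        by (auto simp: realised_def n_def l_def tuples_def)
      define e' where "e' v = (if v \<in> {n * k..<n * k + l} then c ! (v - n * k) else e v)" for v
      have "map (\<lambda>p. e' (n * k + p)) [0..<l] = c"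
        using c(1) by (auto simp: e'_def intro!: nth_equalityI)
      moreover have e'e: "\<forall>v. v \<notin> {n * k..<n * k + l} \<longrightarrow> e' v = e v" by (simp add: e'_def)
      ultimately have "\<forall>i\<in>{..<n}. sat M (e' \<circ> \<sigma> i) (body \<phi>) = t ! i"
        using c(2) by (simp add: sat_iff)
      with e'e show "\<exists>e'. (\<forall>v. v \<notin> {n * k..<n * k + l} \<longrightarrow> e' v = e v) \<and>
        (\<forall>i\<in>{..<n}. sat M (e' \<circ> \<sigma> i) (body \<phi>) = t ! i)" by blast
    qed
  qed
  ultimately show ?thesis by (simp add: n_def)
qed

text \<open>The signs given by \<open>S\<close> decide every point of \<open>A\<close>, so any
  further pair would contradict one already present; this yields maximality.\<close>

lemma phi_typesI:
  assumes "S \<subseteq> A"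
    and real: "\<And>B. finite B \<Longrightarrow> B \<subseteq> A \<Longrightarrow>
      \<exists>c\<in>tuples (length (xvars \<phi>)). \<forall>a\<in>B. holds M \<phi> c a \<longleftrightarrow> a \<in> S"
  shows "S \<in> phi_types M \<phi> A"
proof -
  define p where "p = (\<lambda>a. (a \<in> S, a)) ` A"
  have "phi_consistent M \<phi> p"
    unfolding phi_consistent_def
  proof (intro allI impI)
    fix q assume "q \<subseteq> p" "finite q"
    moreover from this have "snd ` q \<subseteq> A" by (auto simp: p_def)
    ultimately obtain c where "c \<in> tuples (length (xvars \<phi>))" "\<forall>a\<in>snd ` q. holds M \<phi> c a \<longleftrightarrow> a \<in> S"
      using real[of "snd ` q"] by blast
    then show "\<exists>c\<in>tuples (length (xvars \<phi>)). \<forall>(s, a)\<in>q. holds M \<phi> c a = s"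
      using \<open>q \<subseteq> p\<close> by (intro bexI[of _ c]) (force simp: p_def)+
  qed
  moreover have "q = p" if "p \<subseteq> q" "q \<subseteq> UNIV \<times> A" "phi_consistent M \<phi> q" for q
  proof
    show "q \<subseteq> p"
    proof
      fix z assume z: "z \<in> q"
      obtain s a where sa: "z = (s, a)" by fastforce
      then have a: "a \<in> A" using z that(2) by auto
      then have "{(s, a), (a \<in> S, a)} \<subseteq> q" using z sa that(1) by (auto simp: p_def)
      then have "\<exists>c\<in>tuples (length (xvars \<phi>)). \<forall>(s, a)\<in>{(s, a), (a \<in> S, a)}. holds M \<phi> c a = s"
        using that(3) unfolding phi_consistent_def by (metis finite.emptyI finite.insertI)
      then have "s = (a \<in> S)" by auto
      then show "z \<in> p" using sa a by (simp add: p_def)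
    qed
  qed (rule that)
  ultimately have "is_phi_type M \<phi> A p"
    by (auto simp: is_phi_type_def p_def)
  moreover have "S = {a \<in> A. (True, a) \<in> p}" using \<open>S \<subseteq> A\<close> by (auto simp: p_def)
  ultimately show ?thesis unfolding phi_types_def by blast
qed

lemma phi_types_subset: "S \<in> phi_types M \<phi> A \<Longrightarrow> S \<subseteq> A"
  by (auto simp: phi_types_def)

lemma is_phi_type_realised:
  "is_phi_type M \<phi> A p \<Longrightarrow> q \<subseteq> p \<Longrightarrow> finite q \<Longrightarrow>
    \<exists>c\<in>tuples (length (xvars \<phi>)). \<forall>(s, a)\<in>q. holds M \<phi> c a = s"
  by (simp add: is_phi_type_def phi_consistent_def)

text \<open>If neither sign could be added, finite parts \<open>Q True\<close> and
  \<open>Q False\<close> of \<open>p\<close> would exclude one sign each, and a tuple realising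
  their union could have no truth value at \<open>a\<close>.\<close>

lemma is_phi_type_decides:
  assumes p: "is_phi_type M \<phi> A p" and a: "a \<in> A"
  shows "(True, a) \<in> p \<or> (False, a) \<in> p"
proof (rule ccontr)
  assume "\<not> ((True, a) \<in> p \<or> (False, a) \<in> p)"
  then have notin: "(s, a) \<notin> p" for s by (cases s) auto
  have "\<exists>q \<subseteq> p. finite q \<and> (\<forall>c\<in>tuples (length (xvars \<phi>)).
      (\<forall>(s, a)\<in>q. holds M \<phi> c a = s) \<longrightarrow> holds M \<phi> c a \<noteq> s)" for s
  proof -
    have "\<not> phi_consistent M \<phi> (insert (s, a) p)"
      using p a notin[of s] unfolding is_phi_type_def
      by (metis Sigma_cong UNIV_I insertI1 insert_subset mem_Sigma_iff subset_insertI)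
    then obtain q where q: "q \<subseteq> insert (s, a) p" "finite q"
      "\<And>c. c \<in> tuples (length (xvars \<phi>)) \<Longrightarrow> \<not> (\<forall>(s, a)\<in>q. holds M \<phi> c a = s)"
      unfolding phi_consistent_def by blast
    have "holds M \<phi> c a \<noteq> s"
      if c: "c \<in> tuples (length (xvars \<phi>))" and sat: "\<forall>(s, a)\<in>q - {(s, a)}. holds M \<phi> c a = s" for c
    proof
      assume "holds M \<phi> c a = s"
      then have "\<forall>(s, a)\<in>q. holds M \<phi> c a = s" using sat by auto
      then show False using q(3)[OF c] by simp
    qed
    then show ?thesis using q(1,2) by (intro exI[of _ "q - {(s, a)}"]) auto
  qed
  then obtain Q where Q: "\<And>s. Q s \<subseteq> p" "\<And>s. finite (Q s)"
    "\<And>s c. c \<in> tuples (length (xvars \<phi>)) \<Longrightarrow> (\<forall>(s, a)\<in>Q s. holds M \<phi> c a = s) \<Longrightarrow> holds M \<phi> c a \<noteq> s"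
    by metis
  have "Q True \<union> Q False \<subseteq> p" "finite (Q True \<union> Q False)" using Q(1,2) by auto
  from is_phi_type_realised[OF p this] obtain c
    where "c \<in> tuples (length (xvars \<phi>))" "\<forall>(s, a)\<in>Q True \<union> Q False. holds M \<phi> c a = s"
    by (elim bexE)
  then show False using Q(3)[of c True] Q(3)[of c False] by auto
qed

lemma phi_types_realised:
  assumes S: "S \<in> phi_types M \<phi> A" and B: "finite B" "B \<subseteq> A"
  shows "\<exists>c\<in>tuples (length (xvars \<phi>)). \<forall>a\<in>B. holds M \<phi> c a \<longleftrightarrow> a \<in> S"
proof -
  obtain p where p: "is_phi_type M \<phi> A p" "S = {a \<in> A. (True, a) \<in> p}"
    using S by (auto simp: phi_types_def)
  define q where "q = (\<lambda>a. (a \<in> S, a)) ` B"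
  have "(a \<in> S, a) \<in> p" if "a \<in> A" for a
    using is_phi_type_decides[OF p(1) that] that p(2) by (cases "a \<in> S") auto
  then have "q \<subseteq> p" using B(2) by (auto simp: q_def simp del: mem_Collect_eq)
  moreover have "finite q" using B(1) by (simp add: q_def)
  ultimately have "\<exists>c\<in>tuples (length (xvars \<phi>)). \<forall>(s, a)\<in>q. holds M \<phi> c a = s"
    by (rule is_phi_type_realised[OF p(1)])
  then show ?thesis by (auto simp: q_def)
qed

lemma phi_types_nth_realised:
  assumes "S \<in> phi_types M \<phi> A" "\<And>i. i < n \<Longrightarrow> a i \<in> A"
  shows "realised M \<phi> (map (\<lambda>i. a i \<in> S) [0..<n]) a"
  using phi_types_realised[OF assms(1), of "a ` {..<n}"] assms(2)
  by (auto simp: realised_def image_subset_iff)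

section \<open>Ramsey's theorem and the extraction of indiscernible sequences\<close>

text \<open>Increasing lists stand for finite sets, coloured by the truth value of \<open>P\<close>.
  The properties are treated one after the other: thinning out further by \<open>g\<close> keeps the
  homogeneity already reached, as \<open>g\<close> maps increasing lists to increasing
  lists.\<close>

lemma Ramsey_sorted_lists:
  fixes F :: "(nat \<times> (nat list \<Rightarrow> bool)) set"
  assumes "finite F"
  shows "\<exists>f :: nat \<Rightarrow> nat. strict_mono f \<and> (\<forall>n P is js. (n, P) \<in> F \<and>
    sorted_wrt (<) is \<and> length is = n \<and> sorted_wrt (<) js \<and> length js = n \<longrightarrow>
    P (map f is) = P (map f js))"
  using assms
proof (induction F rule: finite_induct)
  case empty
  show ?case by (intro exI[of _ id]) (auto simp: strict_mono_def)
next
  case (insert x F)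
  obtain n P where x: "x = (n, P)" by fastforce
  obtain f :: "nat \<Rightarrow> nat" where f: "strict_mono f" "\<forall>n P is js. (n, P) \<in> F \<and>
    sorted_wrt (<) is \<and> length is = n \<and> sorted_wrt (<) js \<and> length js = n \<longrightarrow>
    P (map f is) = P (map f js)"
    using insert.IH by blast
  define col where "col X = (if P (map f (sorted_list_of_set X)) then 1 else 0 :: nat)" for X
  have "\<forall>X. X \<subseteq> UNIV \<and> finite X \<and> card X = n \<longrightarrow> col X < 2" by (simp add: col_def)
  from Ramsey[OF infinite_UNIV_nat this] obtain Y t where Y: "infinite Y"
    "\<forall>X. X \<subseteq> Y \<and> finite X \<and> card X = n \<longrightarrow> col X = t"
    by (elim exE conjE)
  define g where "g = enumerate Y"
  have g: "strict_mono g" using Y(1) by (simp add: g_def strict_mono_enumerate)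
  have sorted: "sorted_wrt (<) (map g is)" if "sorted_wrt (<) is" for "is"
    using that g by (auto simp: sorted_wrt_map strict_mono_less elim: sorted_wrt_mono_rel[rotated])
  have col: "P (map f (map g is)) \<longleftrightarrow> t = 1" if "sorted_wrt (<) is" "length is = n" for "is"
  proof -
    have "set (map g is) \<subseteq> Y" using Y(1) by (auto simp: g_def enumerate_in_set)
    moreover have "card (set (map g is)) = n"
      using that sorted[OF that(1)] by (metis distinct_card length_map strict_sorted_iff)
    ultimately have "col (set (map g is)) = t" using Y(2) by blast
    moreover have "sorted_list_of_set (set (map g is)) = map g is"
      using sorted[OF that(1)] by (metis strict_sorted_iff sorted_list_of_set.idem_if_sorted_distinct)
    ultimately show ?thesis by (auto simp: col_def split: if_splits)
  qed
  have "strict_mono (f \<circ> g)" using f(1) g by (simp add: strict_mono_o)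
  moreover have "Q (map (f \<circ> g) is) = Q (map (f \<circ> g) js)"
    if "(m, Q) \<in> insert x F" "sorted_wrt (<) is" "length is = m" "sorted_wrt (<) js" "length js = m"
    for m Q "is" js
  proof (cases "(m, Q) = x")
    case True
    then show ?thesis using col[of "is"] col[of js] that x by simp
  next
    case False
    then show ?thesis using f(2)[rule_format, of m Q "map g is" "map g js"] that sorted by simp
  qed
  ultimately show ?case by (intro exI[of _ "f \<circ> g"]) blast
qed

text \<open>Indiscernibility is a set of conditions \<open>hom P is js\<close>, and Ramsey satisfies
  any finitely many of them on a subsequence of \<open>a\<close>. The conditions in
  \<open>\<Theta>\<close> hold at all increasing positions of \<open>a\<close>, so they survive the
  passage to a subsequence. Compactness does the rest.\<close>

lemma exists_indiscernible:
  fixes M :: "('f, 'r, 'm) struct" and a :: "nat \<Rightarrow> 'm list"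
  assumes sat: "saturated L M" and inf: "infinite (UNIV :: 'm set)" and k: "0 < k"
    and a: "\<And>i. length (a i) = k"
    and \<Theta>: "\<And>P. P \<in> \<Theta> \<Longrightarrow> definable L M {..<N * k} P"
      "\<And>P is. P \<in> \<Theta> \<Longrightarrow> sorted_wrt (<) is \<Longrightarrow> length is = N \<Longrightarrow> P (unblock k (\<lambda>i. a (is ! i)))"
  obtains bs where "length bs = N" "indiscernible L M k bs" "\<And>P. P \<in> \<Theta> \<Longrightarrow> P (unblock k ((!) bs))"
proof -
  \<comment> \<open>If \<open>e\<close> codes a sequence, \<open>e \<circ> ix is\<close> codes its
    subsequence at the positions \<open>is\<close>.\<close>
  define ix where "ix is v = is ! (v div k) * k + v mod k" for "is" and v :: nat
  define H where "H n P is js \<longleftrightarrow> definable L M {..<n * k} P \<and>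
      sorted_wrt (<) is \<and> set is \<subseteq> {..<N} \<and> length is = n \<and>
      sorted_wrt (<) js \<and> set js \<subseteq> {..<N} \<and> length js = n" for n P "is" js
  define hom where "hom P is js = (\<lambda>e. P (e \<circ> ix is) = P (e \<circ> ix js))"
    for P :: "(nat \<Rightarrow> 'm) \<Rightarrow> bool" and "is" js
  define \<Gamma> where "\<Gamma> = \<Theta> \<union> (\<lambda>(n, P, is, js). hom P is js) ` {(n, P, is, js). H n P is js}"
  have definable_ix: "definable L M {..<N * k} (\<lambda>e. P (e \<circ> ix is))"
    if "definable L M {..<n * k} P" "sorted_wrt (<) is" "set is \<subseteq> {..<N}" "length is = n" for n P "is"
  proof (rule definable_mono)
    have ix_div: "ix is v div k = is ! (v div k)" and ix_mod: "ix is v mod k = v mod k" for v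
      using k by (simp_all add: ix_def)
    have "inj_on (ix is) {..<n * k}"
    proof (rule inj_onI)
      fix v w assume vw: "v \<in> {..<n * k}" "w \<in> {..<n * k}" "ix is v = ix is w"
      have "is ! (v div k) = is ! (w div k)" "v mod k = w mod k"
        using vw(3) ix_div ix_mod by metis+
      moreover have "v div k < n" "w div k < n" using vw by (auto intro: less_mult_imp_div_less)
      ultimately have "v div k = w div k" "v mod k = w mod k"
        using that(2,4) by (auto simp: strict_sorted_iff nth_eq_iff_index_eq)
      then show "v = w" by (metis div_mult_mod_eq)
    qed
    then show "definable L M (ix is ` {..<n * k}) (\<lambda>e. P (e \<circ> ix is))"
      by (intro definable_comp that) auto
    show "ix is ` {..<n * k} \<subseteq> {..<N * k}"
    proof
      fix u assume "u \<in> ix is ` {..<n * k}"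
      then obtain v where v: "v < n * k" "u = ix is v" by auto
      then have "is ! (v div k) \<in> set is" using that(4) by (intro nth_mem) (simp add: less_mult_imp_div_less)
      then have "u div k < N" using v(2) ix_div that(3) by auto
      then show "u \<in> {..<N * k}" using k by (simp add: div_less_iff_less_mult)
    qed
  qed
  have "\<exists>e. \<forall>P\<in>\<Gamma>. P e"
  proof (rule saturated_compact[OF sat inf])
    fix R assume "R \<in> \<Gamma>"
    then consider "R \<in> \<Theta>" | n P "is" js where "R = hom P is js" "H n P is js" by (auto simp: \<Gamma>_def)
    then show "\<exists>V. finite V \<and> definable L M V R"
    proof cases
      case 1
      then show ?thesis using \<Theta>(1) by blast
    next
      case (2 n P "is" js)
      have 1: "definable L M {..<N * k} (\<lambda>e. P (e \<circ> ix is))"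
        and 2: "definable L M {..<N * k} (\<lambda>e. P (e \<circ> ix js))"
        using 2(2) definable_ix by (auto simp: H_def)
      \<comment> \<open>The equivalence is spelled out by negation and conjunction, under which
        definability is closed.\<close>
      have "R = (\<lambda>e. \<not> (P (e \<circ> ix is) \<and> \<not> P (e \<circ> ix js)) \<and> \<not> (P (e \<circ> ix js) \<and> \<not> P (e \<circ> ix is)))"
        using \<open>R = hom P is js\<close> by (auto simp: hom_def)
      then have "definable L M {..<N * k} R"
        using 1 2 by (simp only:) (intro definable_Conj definable_Not)
      then show ?thesis by blast
    qed
  next
    fix q assume q: "q \<subseteq> \<Gamma>" "finite q"
    \<comment> \<open>Only the conditions outside \<open>\<Theta>\<close> call for Ramsey.\<close>
    have "q - \<Theta> \<subseteq> (\<lambda>(n, P, is, js). hom P is js) ` {(n, P, is, js). H n P is js}"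
      using q(1) by (auto simp: \<Gamma>_def)
    from finite_subset_image[OF finite_Diff[OF q(2)] this]
    obtain G where G: "G \<subseteq> {(n, P, is, js). H n P is js}" "finite G"
      "q - \<Theta> = (\<lambda>(n, P, is, js). hom P is js) ` G"
      by (elim exE conjE)
    define F where "F = (\<lambda>(n, P, is, js). (n, \<lambda>is. P (unblock k (\<lambda>i. a (is ! i))))) ` G"
    have "finite F" using G(2) by (simp add: F_def)
    from Ramsey_sorted_lists[OF this] obtain f :: "nat \<Rightarrow> nat" where f: "strict_mono f"
      "\<forall>n P is js. (n, P) \<in> F \<and> sorted_wrt (<) is \<and> length is = n \<and> sorted_wrt (<) js \<and> length js = n \<longrightarrow>
        P (map f is) = P (map f js)" by blast
    define e where "e = unblock k (\<lambda>i. a (f i))"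
    have e_ix: "P (e \<circ> ix is) = P (unblock k (\<lambda>i. a (map f is ! i)))"
      if "definable L M {..<n * k} P" "length is = n" for P n "is"
    proof (rule definable_cong[OF that(1)])
      fix v assume "v \<in> {..<n * k}"
      then have "v div k < n" by (auto intro: less_mult_imp_div_less)
      then show "(e \<circ> ix is) v = unblock k (\<lambda>i. a (map f is ! i)) v"
        using k that(2) by (simp add: e_def unblock_def ix_def)
    qed
    have "R e" if R: "R \<in> q" for R
    proof (cases "R \<in> \<Theta>")
      case True
      have "sorted_wrt (<) (map f [0..<N])"
        using f(1) by (simp add: sorted_wrt_map strict_mono_less)
      then have "R (unblock k (\<lambda>i. a (map f [0..<N] ! i)))" using \<Theta>(2)[OF True] by simp
      moreover have "R (unblock k (\<lambda>i. a (map f [0..<N] ! i))) = R e"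
        by (rule definable_cong[OF \<Theta>(1)[OF True]]) (use less_mult_imp_div_less in \<open>auto simp: e_def unblock_def\<close>)
      ultimately show ?thesis by simp
    next
      case False
      then have "R \<in> (\<lambda>(n, P, is, js). hom P is js) ` G" using R G(3) by blast
      then obtain z where z: "z \<in> G" "R = (\<lambda>(n, P, is, js). hom P is js) z" by blast
      obtain n P "is" js where z_eq: "z = (n, P, is, js)" by (rule prod_cases4)
      have R_eq: "R = hom P is js" and HR: "H n P is js" using z z_eq G(1) by auto
      have "(n, \<lambda>is. P (unblock k (\<lambda>i. a (is ! i)))) \<in> F"
        unfolding F_def using z(1) z_eq by (intro image_eqI[of _ _ z]) auto
      then have "P (unblock k (\<lambda>i. a (map f is ! i))) = P (unblock k (\<lambda>i. a (map f js ! i)))"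
        using f(2) HR unfolding H_def by blast
      then show ?thesis using R_eq HR e_ix[of n P "is"] e_ix[of n P js] by (simp add: hom_def H_def)
    qed
    then show "\<exists>e. \<forall>R\<in>q. R e" by blast
  qed
  then obtain e where e: "\<And>P. P \<in> \<Gamma> \<Longrightarrow> P e" by blast
  define bs where "bs = map (\<lambda>i. block k i e) [0..<N]"
  have lenbs: "length bs = N" by (simp add: bs_def)
  have unb: "P (unblock k (\<lambda>i. bs ! (is ! i))) = P (e \<circ> ix is)"
    if "definable L M {..<n * k} P" "set is \<subseteq> {..<N}" "length is = n" for P n "is"
  proof (rule definable_cong[OF that(1)])
    fix v assume "v \<in> {..<n * k}"
    then have "v div k < n" by (auto intro: less_mult_imp_div_less)
    then have "is ! (v div k) < N" using that nth_mem by blast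
    then show "unblock k (\<lambda>i. bs ! (is ! i)) v = (e \<circ> ix is) v"
      using k by (simp add: bs_def unblock_def ix_def block_def)
  qed
  show ?thesis
  proof
    show "length bs = N" by (rule lenbs)
    show "indiscernible L M k bs"
      unfolding indiscernible_iff[OF k]
    proof (intro conjI allI impI)
      show "set bs \<subseteq> tuples k" by (auto simp: bs_def tuples_def)
      fix "is" js P
      assume asm: "sorted_wrt (<) is \<and> set is \<subseteq> {..<length bs} \<and>
        sorted_wrt (<) js \<and> set js \<subseteq> {..<length bs} \<and>
        length js = length is \<and> definable L M {..<length is * k} P"
      then have "H (length is) P is js" by (simp add: H_def bs_def)
      then have "hom P is js \<in> \<Gamma>" unfolding \<Gamma>_def by force
      from e[OF this] show "P (unblock k (\<lambda>i. bs ! (is ! i))) = P (unblock k (\<lambda>j. bs ! (js ! j)))"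
        using asm unb[of "length is" P "is"] unb[of "length is" P js] lenbs by (simp add: hom_def)
    qed
    fix P assume P: "P \<in> \<Theta>"
    have "P (unblock k ((!) bs)) = P e"
    proof (rule definable_cong[OF \<Theta>(1)[OF P]])
      fix v assume "v \<in> {..<N * k}"
      then have "v div k < N" by (auto intro: less_mult_imp_div_less)
      then show "unblock k ((!) bs) v = e v"
        using k by (simp add: bs_def unblock_def block_def)
    qed
    then show "P (unblock k ((!) bs))" using e[of P] P by (simp add: \<Gamma>_def)
  qed
qed

section \<open>From a maximum trace to indiscernible sequences with many types\<close>

lemma finite_phi_types: "finite A \<Longrightarrow> finite (phi_types M \<phi> A)"
  by (rule finite_subset[of _ "Pow A"]) (auto dest: phi_types_subset)

text \<open>The sequence may repeat entries, but a realised word takes equal values at equal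
  entries, these being the truth values of one tuple. So the word can be read off from the set of
  entries that it selects.\<close>

lemma realised_card_le_phi_types:
  assumes T: "\<And>t. t \<in> T \<Longrightarrow> length t = length bs \<and> realised M \<phi> t ((!) bs)"
  shows "card T \<le> card (phi_types M \<phi> (set bs))"
proof (rule card_inj_on_le)
  let ?f = "\<lambda>t. {bs ! i | i. i < length bs \<and> t ! i}"
  have key: "\<exists>c\<in>tuples (length (xvars \<phi>)). (\<forall>i<length bs. holds M \<phi> c (bs ! i) = t ! i) \<and>
      (\<forall>a\<in>set bs. holds M \<phi> c a \<longleftrightarrow> a \<in> ?f t)" if t: "t \<in> T" for t
  proof -
    obtain c where c: "c \<in> tuples (length (xvars \<phi>))" "\<forall>i<length bs. holds M \<phi> c (bs ! i) = t ! i"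
      using T[OF t] by (auto simp: realised_def)
    moreover have "\<forall>a\<in>set bs. holds M \<phi> c a \<longleftrightarrow> a \<in> ?f t"
      using c(2) by (fastforce simp: in_set_conv_nth)
    ultimately show ?thesis by blast
  qed
  have mem: "bs ! i \<in> ?f t \<longleftrightarrow> t ! i" if t: "t \<in> T" and i: "i < length bs" for t i
  proof -
    obtain c where "\<forall>i<length bs. holds M \<phi> c (bs ! i) = t ! i"
      and c: "\<forall>a\<in>set bs. holds M \<phi> c a \<longleftrightarrow> a \<in> ?f t"
      using key[OF t] by blast
    then have "holds M \<phi> c (bs ! i) = t ! i" using i by blast
    moreover have "holds M \<phi> c (bs ! i) \<longleftrightarrow> bs ! i \<in> ?f t" using c nth_mem[OF i] by (rule bspec)
    ultimately show ?thesis by (simp only:)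
  qed
  show "inj_on ?f T"
  proof (rule inj_onI)
    fix t t' assume t: "t \<in> T" "t' \<in> T" and eq: "?f t = ?f t'"
    show "t = t'"
    proof (rule nth_equalityI)
      show "length t = length t'" using T t by simp
      fix i assume "i < length t"
      then have i: "i < length bs" using T t by simp
      show "t ! i = t' ! i" using mem[OF t(1) i] mem[OF t(2) i] eq by (simp only:)
    qed
  qed
  show "?f ` T \<subseteq> phi_types M \<phi> (set bs)"
  proof (rule image_subsetI)
    fix t assume t: "t \<in> T"
    show "?f t \<in> phi_types M \<phi> (set bs)"
    proof (rule phi_typesI)
      fix B assume "B \<subseteq> set bs"
      then show "\<exists>c\<in>tuples (length (xvars \<phi>)). \<forall>a\<in>B. holds M \<phi> c a \<longleftrightarrow> a \<in> ?f t"
        using key[OF t] by blast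
    qed auto
  qed
qed (simp add: finite_phi_types)

lemma card_phi_types_le_realised:
  "card (phi_types M \<phi> (set bs)) \<le> card {t. length t = length bs \<and> realised M \<phi> t ((!) bs)}"
proof (rule card_inj_on_le)
  let ?f = "\<lambda>S. map (\<lambda>i. bs ! i \<in> S) [0..<length bs]"
  show "inj_on ?f (phi_types M \<phi> (set bs))"
  proof (rule inj_onI)
    fix S S' assume S: "S \<in> phi_types M \<phi> (set bs)" "S' \<in> phi_types M \<phi> (set bs)" and eq: "?f S = ?f S'"
    have "bs ! i \<in> S \<longleftrightarrow> bs ! i \<in> S'" if "i < length bs" for i
      using arg_cong[OF eq, of "\<lambda>t. t ! i"] that by simp
    then show "S = S'"
      using phi_types_subset[OF S(1)] phi_types_subset[OF S(2)] by (metis in_set_conv_nth subset_iff subset_antisym)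
  qed
  show "?f ` phi_types M \<phi> (set bs) \<subseteq> {t. length t = length bs \<and> realised M \<phi> t ((!) bs)}"
    by (auto intro!: phi_types_nth_realised)
  show "finite {t. length t = length bs \<and> realised M \<phi> t ((!) bs)}"
    by (rule finite_subset[OF _ finite_bool_lists_le[of "length bs"]]) auto
qed

text \<open>A first use of Ramsey thins out an enumeration of \<open>A\<close> until the set
  \<open>T\<close> of realised words of length \<open>N\<close> is the same at all increasing
  positions. These words become the conditions \<open>\<Theta>\<close> for the extraction, and the
  traces of \<open>\<C>\<close> on \<open>N\<close> points show that there are at least
  \<open>binom_le N d\<close> of them.\<close>

lemma maximum_trace_indiscernible:
  fixes M :: "('f, 'r, 'm) struct"
  assumes sat: "saturated L M" and inf: "infinite (UNIV :: 'm set)"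
    and pf: "partitioned_formula L \<phi>"
    and A: "A \<subseteq> tuples (length (yvars \<phi>))" "A \<approx> (UNIV :: nat set)"
    and \<C>: "\<C> \<subseteq> phi_types M \<phi> A" "maximum_sys d A \<C>"
  obtains bs where "length bs = N" "indiscernible L M (length (yvars \<phi>)) bs"
    "binom_le N d \<le> card (phi_types M \<phi> (set bs))"
proof -
  define k where "k = length (yvars \<phi>)"
  have k: "0 < k" using pf by (simp add: k_def partitioned_formula_def)
  obtain h where h: "bij_betw h (UNIV :: nat set) A"
    using A(2) eqpoll_sym unfolding eqpoll_def by blast
  have len: "length (h i) = k" for i
    using A(1) h by (auto simp: bij_betw_def k_def tuples_def)
  define F where "F = (\<lambda>t. (N, \<lambda>is. realised M \<phi> t (\<lambda>i. h (is ! i)))) ` {t. length t = N}"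
  have "finite {t :: bool list. length t = N}"
    by (rule finite_subset[OF _ finite_bool_lists_le[of N]]) auto
  then have "finite F" by (simp add: F_def)
  from Ramsey_sorted_lists[OF this] obtain f :: "nat \<Rightarrow> nat" where f: "strict_mono f"
    "\<forall>n P is js. (n, P) \<in> F \<and> sorted_wrt (<) is \<and> length is = n \<and> sorted_wrt (<) js \<and> length js = n \<longrightarrow>
      P (map f is) = P (map f js)" by blast
  define a where "a i = h (f i)" for i
  have inj: "inj a"
    using h strict_mono_eq[OF f(1)] by (auto simp: a_def bij_betw_def inj_def)
  have aA: "a i \<in> A" for i using h by (auto simp: a_def bij_betw_def)
  define T where "T = {t. length t = N \<and> realised M \<phi> t a}"
  have T: "realised M \<phi> t (\<lambda>i. a (is ! i))" if "t \<in> T" "sorted_wrt (<) is" "length is = N" for t "is"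
  proof -
    have t: "length t = N" "realised M \<phi> t a" using that(1) by (auto simp: T_def)
    have "(N, \<lambda>is. realised M \<phi> t (\<lambda>i. h (is ! i))) \<in> F" using t by (auto simp: F_def)
    from f(2)[rule_format, OF conjI[OF this], of "is" "[0..<N]"] that(2,3)
    have "realised M \<phi> t (\<lambda>i. h (map f is ! i)) = realised M \<phi> t (\<lambda>i. h (map f [0..<N] ! i))"
      by simp
    moreover have "realised M \<phi> t (\<lambda>i. h (map f is ! i)) = realised M \<phi> t (\<lambda>i. a (is ! i))"
      by (rule realised_cong) (use t that in \<open>simp add: a_def\<close>)
    moreover have "realised M \<phi> t (\<lambda>i. h (map f [0..<N] ! i)) = realised M \<phi> t a"
      by (rule realised_cong) (use t in \<open>simp add: a_def\<close>)
    ultimately show ?thesis using t by simp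
  qed
  define \<Theta> where "\<Theta> = (\<lambda>t e. realised M \<phi> t (\<lambda>i. block k i e)) ` T"
  obtain bs where bs: "length bs = N" "indiscernible L M k bs"
    "\<And>P. P \<in> \<Theta> \<Longrightarrow> P (unblock k ((!) bs))"
  proof (rule exists_indiscernible[OF sat inf k])
    show "length (a i) = k" for i by (simp add: a_def len)
    show "definable L M {..<N * k} P" if P: "P \<in> \<Theta>" for P
      using P definable_realised[OF pf] by (auto simp: \<Theta>_def T_def k_def)
    show "P (unblock k (\<lambda>i. a (is ! i)))"
      if "P \<in> \<Theta>" "sorted_wrt (<) is" "length is = N" for P "is"
      using that T by (auto simp: \<Theta>_def block_unblock a_def len)
  qed (rule that)
  have lenbs: "length (bs ! i) = k" if "i < N" for i
    using bs(1,2) that by (simp add: indiscernible_length)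
  have real: "realised M \<phi> t ((!) bs)" if t: "t \<in> T" for t
  proof -
    have "realised M \<phi> t (\<lambda>i. block k i (unblock k ((!) bs)))"
      using bs(3)[of "\<lambda>e. realised M \<phi> t (\<lambda>i. block k i e)"] t by (simp add: \<Theta>_def)
    moreover have "realised M \<phi> t (\<lambda>i. block k i (unblock k ((!) bs))) = realised M \<phi> t ((!) bs)"
      by (rule realised_cong) (use t lenbs in \<open>simp add: T_def block_unblock\<close>)
    ultimately show ?thesis by simp
  qed
  \<comment> \<open>By injectivity of \<open>a\<close> these are \<open>N\<close> distinct points of
    \<open>A\<close>.\<close>
  let ?B = "a ` {..<N}"
  have "binom_le N d = card (restrict_sys \<C> ?B)"
    using \<C>(2) aA inj_on_subset[OF inj] by (auto simp: maximum_sys_def card_image image_subset_iff)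
  also have "\<dots> \<le> card T"
  proof (rule card_inj_on_le)
    let ?g = "\<lambda>S. map (\<lambda>i. a i \<in> S) [0..<N]"
    show "inj_on ?g (restrict_sys \<C> ?B)"
    proof (rule inj_onI)
      fix S S' assume S: "S \<in> restrict_sys \<C> ?B" "S' \<in> restrict_sys \<C> ?B" and eq: "?g S = ?g S'"
      have "a i \<in> S \<longleftrightarrow> a i \<in> S'" if "i < N" for i
        using arg_cong[OF eq, of "\<lambda>t. t ! i"] that by simp
      then show "S = S'" using S by (auto simp: restrict_sys_def)
    qed
    show "?g ` restrict_sys \<C> ?B \<subseteq> T"
    proof (rule image_subsetI)
      fix S assume "S \<in> restrict_sys \<C> ?B"
      then obtain C where C: "C \<in> \<C>" "S = C \<inter> ?B" by (auto simp: restrict_sys_def)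
      have "realised M \<phi> (map (\<lambda>i. a i \<in> C) [0..<N]) a"
        using C(1) \<C>(1) aA by (intro phi_types_nth_realised) auto
      moreover have "map (\<lambda>i. a i \<in> C) [0..<N] = ?g S" using C(2) by auto
      ultimately show "?g S \<in> T" by (simp add: T_def)
    qed
    show "finite T"
      by (rule finite_subset[OF _ finite_bool_lists_le[of N]]) (auto simp: T_def)
  qed
  also have "\<dots> \<le> card (phi_types M \<phi> (set bs))"
    by (rule realised_card_le_phi_types) (use real bs(1) in \<open>auto simp: T_def\<close>)
  finally show ?thesis using that bs(1,2) by (simp add: k_def)
qed

section \<open>From many types to a maximum trace\<close>

lemma subseq_conv_map_nth:
  assumes "subseq t w"
  obtains "is" where "sorted_wrt (<) is" "set is \<subseteq> {..<length w}" "t = map ((!) w) is"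
proof -
  obtain I where "t = nths w I" using assms by (auto simp: subseq_conv_nths)
  also have "nths w I = map ((!) w) (filter (\<lambda>i. i \<in> I) [0..<length w])"
    by (induction w rule: rev_induct) (simp_all add: nths_append nth_append)
  finally show ?thesis using that[of "filter (\<lambda>i. i \<in> I) [0..<length w]"]
    by (auto simp: sorted_wrt_filter)
qed

text \<open>A tuple realising \<open>w\<close> realises \<open>t\<close> at the positions
  \<open>is\<close> where \<open>t\<close> sits in \<open>w\<close>. That some tuple does so is a
  definable condition on the terms there, so indiscernibility moves it to the initial positions
  \<open>js\<close>.\<close>

lemma indiscernible_realised_subseq:
  assumes pf: "partitioned_formula L \<phi>" and ind: "indiscernible L M (length (yvars \<phi>)) bs"
    and w: "realised M \<phi> w ((!) bs)" "length w = length bs" and t: "subseq t w"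
  shows "realised M \<phi> t ((!) bs)"
proof -
  define k where "k = length (yvars \<phi>)"
  have k: "0 < k" using pf by (simp add: k_def partitioned_formula_def)
  obtain "is" where "is": "sorted_wrt (<) is" "set is \<subseteq> {..<length w}" "t = map ((!) w) is"
    using t by (rule subseq_conv_map_nth)
  have len: "length (bs ! i) = k" if "i < length bs" for i
    using ind that by (simp add: indiscernible_length k_def)
  define js where "js = [0..<length t]"
  have tbs: "length t \<le> length bs" using t w(2) by (metis list_emb_length)
  have is_nth: "is ! i < length bs" if "i < length is" for i
    using "is"(2) w(2) nth_mem[OF that] by auto
  define P where "P = (\<lambda>e. realised M \<phi> t (\<lambda>i. block k i e))"
  have "P (unblock k (\<lambda>i. bs ! (is ! i))) = P (unblock k (\<lambda>i. bs ! (js ! i)))"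
  proof (rule conjunct2[OF ind[folded k_def, unfolded indiscernible_iff[OF k]], rule_format], intro conjI)
    show "definable L M {..<length is * k} P"
      using definable_realised[OF pf, of M t] "is"(3) by (simp add: P_def k_def)
  qed (use "is" w(2) tbs in \<open>auto simp: js_def\<close>)
  moreover have "P (unblock k (\<lambda>i. bs ! (is ! i))) = realised M \<phi> t (\<lambda>i. bs ! (is ! i))"
    unfolding P_def by (rule realised_cong) (use len is_nth "is"(3) in \<open>simp add: block_unblock\<close>)
  moreover have "P (unblock k (\<lambda>i. bs ! (js ! i))) = realised M \<phi> t (\<lambda>i. bs ! (js ! i))"
    unfolding P_def by (rule realised_cong) (use len tbs in \<open>simp add: block_unblock js_def\<close>)
  moreover have "realised M \<phi> t (\<lambda>i. bs ! (js ! i)) = realised M \<phi> t ((!) bs)"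
    by (rule realised_cong) (simp add: js_def)
  moreover have "realised M \<phi> t (\<lambda>i. bs ! (is ! i))"
    using w is_nth "is"(3) by (auto simp: realised_def)
  ultimately show ?thesis by simp
qed

lemma realised_block_word:
  fixes M :: "('f, 'r, 'm) struct"
  assumes many: "\<And>K. \<exists>bs. bs \<noteq> [] \<and> indiscernible L M k bs \<and>
    K * length bs ^ d \<le> card (phi_types M \<phi> (set bs))"
  shows "\<exists>bs w cs c. indiscernible L M k bs \<and> realised M \<phi> w ((!) bs) \<and> length w = length bs \<and>
    length cs = Suc d \<and> subseq (block_word m cs c) w"
proof (rule ccontr)
  assume contra: "\<not> ?thesis"
  obtain K where K: "\<And>N. card {w \<in> block_free m (Suc d). length w = N} \<le> K * Suc N ^ d"
    using card_block_free_length by blast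
  \<comment> \<open>The factor \<open>2 ^ d\<close> pays for passing from \<open>Suc N\<close> to
    \<open>2 * N\<close>; the outer \<open>Suc\<close> makes the contradiction strict, since
    \<open>bs\<close> is nonempty.\<close>
  obtain bs where bs: "bs \<noteq> []" "indiscernible L M k bs"
    "Suc (K * 2 ^ d) * length bs ^ d \<le> card (phi_types M \<phi> (set bs))"
    using many by blast
  define N where "N = length bs"
  have "card (phi_types M \<phi> (set bs)) \<le> card {t. length t = N \<and> realised M \<phi> t ((!) bs)}"
    unfolding N_def by (rule card_phi_types_le_realised)
  also have "\<dots> \<le> card {w \<in> block_free m (Suc d). length w = N}"
  proof (rule card_mono)
    show "finite {w \<in> block_free m (Suc d). length w = N}"
      by (rule finite_subset[OF _ finite_bool_lists_le[of N]]) auto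
    show "{t. length t = N \<and> realised M \<phi> t ((!) bs)} \<subseteq> {w \<in> block_free m (Suc d). length w = N}"
      using contra bs(2) unfolding block_free_def N_def by blast
  qed
  also have "\<dots> \<le> K * Suc N ^ d" by (rule K)
  also have "\<dots> \<le> K * (2 * N) ^ d"
  proof -
    have "Suc N \<le> 2 * N" using bs(1) by (cases bs) (auto simp: N_def)
    then show ?thesis by (intro mult_le_mono2 power_mono) auto
  qed
  also have "\<dots> < Suc (K * 2 ^ d) * N ^ d"
    using bs(1) by (simp add: N_def power_mult_distrib)
  finally show False using bs(3) by (simp add: N_def)
qed

text \<open>There are finitely many choices of letters. If each failed at some \<open>m\<close>,
  then by monotonicity all would fail at the largest of these values.\<close>

lemma uniform_block_word:
  fixes P :: "nat \<Rightarrow> bool list \<Rightarrow> bool \<Rightarrow> bool"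
  assumes ex: "\<And>m. \<exists>cs c. length cs = n \<and> P m cs c"
    and anti: "\<And>m m' cs c. m \<le> m' \<Longrightarrow> P m' cs c \<Longrightarrow> P m cs c"
  obtains cs :: "bool list" and c where "length cs = n" "\<And>m. P m cs c"
proof (rule ccontr)
  assume no: "\<not> thesis"
  define I where "I = {cs :: bool list. length cs = n} \<times> (UNIV :: bool set)"
  have fin: "finite I" unfolding I_def
    by (intro finite_cartesian_product finite_subset[OF _ finite_bool_lists_le[of n]]) auto
  have "\<forall>x\<in>I. \<exists>m. \<not> P m (fst x) (snd x)" using no that by (fastforce simp: I_def)
  then obtain f where f: "\<And>x. x \<in> I \<Longrightarrow> \<not> P (f x) (fst x) (snd x)" by metis
  obtain cs c where cs: "length cs = n" "P (Max (f ` I)) cs c" using ex by blast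
  then have "(cs, c) \<in> I" by (simp add: I_def)
  then have "f (cs, c) \<le> Max (f ` I)" using fin by simp
  then show False using f[OF \<open>(cs, c) \<in> I\<close>] anti cs(2) by fastforce
qed

text \<open>The unknown is one valuation coding an infinite sequence, and each condition asks for
  one jump word to be realised on an initial segment. Finitely many conditions involve words shorter
  than some \<open>m\<close>; all of these embed in the block word with runs of length
  \<open>m\<close>, so one finite indiscernible sequence realises them at the same
  positions.\<close>

lemma exists_maximum_trace:
  fixes M :: "('f, 'r, 'm) struct"
  assumes sat: "saturated L M" and inf: "infinite (UNIV :: 'm set)"
    and pf: "partitioned_formula L \<phi>"
    and many: "\<And>K. \<exists>bs. bs \<noteq> [] \<and> indiscernible L M (length (yvars \<phi>)) bs \<and>
      K * length bs ^ d \<le> card (phi_types M \<phi> (set bs))"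
  obtains A \<C> where "A \<subseteq> tuples (length (yvars \<phi>))" "A \<approx> (UNIV :: nat set)"
    "\<C> \<in> traces M \<phi> A" "maximum_sys (Suc d) A \<C>"
proof -
  define k where "k = length (yvars \<phi>)"
  have k: "0 < k" using pf by (simp add: k_def partitioned_formula_def)
  define P where "P m cs c \<longleftrightarrow> (\<exists>bs w. indiscernible L M k bs \<and> realised M \<phi> w ((!) bs) \<and>
    length w = length bs \<and> subseq (block_word m cs c) w)" for m cs c
  obtain cs c where cs: "length cs = Suc d" and P: "\<And>m. P m cs c"
  proof (rule uniform_block_word[of "Suc d" P])
    show "\<exists>cs c. length cs = Suc d \<and> P m cs c" for m
      using realised_block_word[OF many, of m] by (fastforce simp: P_def k_def)
    show "P m cs c" if "m \<le> m'" "P m' cs c" for m m' cs c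
      using that subseq_block_word_mono[OF that(1), of cs c] unfolding P_def
      by (meson subseq_order.order_trans)
  qed blast
  \<comment> \<open>The \<open>Suc d\<close> letters of \<open>cs\<close> precede jumps; the last
    run letter \<open>c\<close> is the one after \<open>Suc d\<close> jumps.\<close>
  define col where "col i = (cs @ [c]) ! i" for i
  have cs_col: "cs = map col [0..<Suc d]" "c = col (Suc d)"
    using cs by (auto simp: col_def nth_append simp del: upt_Suc intro!: nth_equalityI)
  define word where "word n J = map (\<lambda>i. i \<in> jump_set col J) [0..<n]" for n J
  define \<J> where "\<J> = {J :: nat set. finite J \<and> card J \<le> Suc d}"
  define \<Gamma> where "\<Gamma> = (\<lambda>(n, J) e. realised M \<phi> (word n J) (\<lambda>i. block k i e)) ` (UNIV \<times> \<J>)"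
  have "\<exists>e. \<forall>P\<in>\<Gamma>. P e"
  proof (rule saturated_compact[OF sat inf])
    show "\<exists>V. finite V \<and> definable L M V P" if "P \<in> \<Gamma>" for P
      using that definable_realised[OF pf] unfolding \<Gamma>_def k_def by fast
  next
    fix q assume q: "q \<subseteq> \<Gamma>" "finite q"
    obtain G where G: "G \<subseteq> UNIV \<times> \<J>" "finite G"
      "q = (\<lambda>(n, J) e. realised M \<phi> (word n J) (\<lambda>i. block k i e)) ` G"
      using finite_subset_image[OF q(2) q(1)[unfolded \<Gamma>_def]] by blast
    obtain m where m: "\<And>n J. (n, J) \<in> G \<Longrightarrow> n < m"
    proof -
      have "finite (fst ` G)" using G(2) by simp
      then obtain m where "fst ` G \<subseteq> {..<m}" using finite_nat_iff_bounded by blast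
      then have "n < m" if "(n, J) \<in> G" for n J using that by force
      then show ?thesis by (rule that)
    qed
    obtain bs w where bs: "indiscernible L M k bs" and w: "realised M \<phi> w ((!) bs)" "length w = length bs"
      "subseq (block_word m cs c) w" using P[of m] unfolding P_def by blast
    have len: "length (bs ! i) = k" if "i < length bs" for i
      using bs that by (rule indiscernible_length)
    have "realised M \<phi> (word n J) (\<lambda>i. block k i (unblock k ((!) bs)))" if nJ: "(n, J) \<in> G" for n J
    proof -
      have J: "finite J" "card J \<le> Suc d" using nJ G(1) by (auto simp: \<J>_def)
      have sub: "subseq (word n J) w"
        using jump_set_subseq_block_word[OF J, of col n] subseq_block_word_mono[of n m cs c]
          m[OF nJ] w(3) unfolding word_def cs_col[symmetric]
        by (meson less_imp_le_nat subseq_order.order_trans)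
      \<comment> \<open>The valuation means nothing past the end of \<open>bs\<close>, but the word
        fits into \<open>bs\<close>.\<close>
      then have "length (word n J) \<le> length bs" using w(2) by (metis list_emb_length)
      then have "realised M \<phi> (word n J) (\<lambda>i. block k i (unblock k ((!) bs))) = realised M \<phi> (word n J) ((!) bs)"
        using len by (intro realised_cong) (simp add: block_unblock)
      then show ?thesis
        using indiscernible_realised_subseq[OF pf bs[unfolded k_def] w(1,2) sub] by simp
    qed
    then show "\<exists>e. \<forall>P\<in>q. P e" unfolding G(3) by (intro exI[of _ "unblock k ((!) bs)"]) auto
  qed
  then obtain e where e: "\<And>n J. J \<in> \<J> \<Longrightarrow> realised M \<phi> (word n J) (\<lambda>i. block k i e)"
    by (auto simp: \<Gamma>_def)
  define b where "b i = block k i e" for i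
  have real: "\<exists>x\<in>tuples (length (xvars \<phi>)). \<forall>i<n. holds M \<phi> x (b i) \<longleftrightarrow> i \<in> jump_set col J"
    if "J \<in> \<J>" for n J
    using e[OF that, of n] by (auto simp: realised_def word_def b_def)
  text \<open>The set \<open>jump_set col {j}\<close> separates \<open>j\<close> from all smaller points.\<close>
  have "b i \<noteq> b j" if "i < j" for i j
  proof
    assume eq: "b i = b j"
    have "{j} \<in> \<J>" by (simp add: \<J>_def)
    from real[OF this, of "Suc j"] obtain x
      where x: "\<forall>i<Suc j. holds M \<phi> x (b i) \<longleftrightarrow> i \<in> jump_set col {j}" by blast
    have "i \<in> jump_set col {j} \<longleftrightarrow> j \<in> jump_set col {j}"
      using x eq that by (metis lessI less_SucI)
    then show False using that by (simp add: jump_set_def)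
  qed
  then have inj: "inj b" by (metis injI linorder_neqE_nat)
  define \<C> where "\<C> = (`) b ` jump_set col ` \<J>"
  show ?thesis
  proof (rule that)
    show "range b \<subseteq> tuples (length (yvars \<phi>))" by (auto simp: b_def tuples_def k_def)
    show "range b \<approx> (UNIV :: nat set)" using inj by (rule inj_on_image_eqpoll_self)
    show "maximum_sys (Suc d) (range b) \<C>"
      unfolding \<C>_def \<J>_def by (intro maximum_sys_image maximum_sys_jump_set inj)
    have "b ` jump_set col J \<in> phi_types M \<phi> (range b)" if J: "J \<in> \<J>" for J
    proof (rule phi_typesI)
      fix B assume B: "finite B" "B \<subseteq> range b"
      then obtain I where I: "finite I" "B = b ` I" using finite_subset_image by metis
      then obtain n where n: "I \<subseteq> {..<n}" using finite_nat_iff_bounded by blast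
      obtain x where x: "x \<in> tuples (length (xvars \<phi>))" "\<forall>i<n. holds M \<phi> x (b i) \<longleftrightarrow> i \<in> jump_set col J"
        using real[OF J] by blast
      have "\<forall>a\<in>B. holds M \<phi> x a \<longleftrightarrow> a \<in> b ` jump_set col J"
        using x(2) n I(2) inj by (auto simp: inj_image_mem_iff)
      then show "\<exists>x\<in>tuples (length (xvars \<phi>)). \<forall>a\<in>B. holds M \<phi> x a \<longleftrightarrow> a \<in> b ` jump_set col J"
        using x(1) by blast
    qed auto
    then show "\<C> \<in> traces M \<phi> (range b)" by (auto simp: \<C>_def traces_def)
  qed
qed

section \<open>Infinity of the model, dimension zero and the growth exponent\<close>

lemma infinite_formulas: "infinite (formulas L)"
proof -
  have "inj (\<lambda>n. Eq (Var n) (Var n))" by (auto simp: inj_def)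
  moreover have "range (\<lambda>n. Eq (Var n) (Var n)) \<subseteq> formulas L" by (auto simp: formulas_def)
  ultimately show ?thesis by (metis infinite_super range_inj_infinite)
qed

lemma infinite_monster:
  fixes M :: "('f, 'r, 'm) struct"
  assumes "monster_model L T M"
  shows "infinite (UNIV :: 'm set)"
proof
  assume fin: "finite (UNIV :: 'm set)"
  have "formulas L \<lesssim> (UNIV :: 'm set)"
    using assms by (simp add: monster_model_def lesspoll_def)
  then obtain f :: "_ \<Rightarrow> 'm" where "inj_on f (formulas L)" by (auto simp: lepoll_def)
  then show False
    using infinite_formulas[of L] finite_imageD[of f] finite_subset[OF subset_UNIV fin] by blast
qed

lemma maximum_sys_0: "C \<subseteq> X \<Longrightarrow> maximum_sys 0 X {C}"
  by (auto simp: maximum_sys_def restrict_sys_eq_image binom_le_def)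

text \<open>A single type is a 0-maximum system; the type of an arbitrary tuple \<open>c\<close>
  over any countably infinite set of parameters will do.\<close>

lemma exists_maximum_trace_0:
  fixes M :: "('f, 'r, 'm) struct"
  assumes inf: "infinite (UNIV :: 'm set)" and pf: "partitioned_formula L \<phi>"
  shows "\<exists>A \<subseteq> tuples (length (yvars \<phi>)). A \<approx> (UNIV :: nat set) \<and> (\<exists>\<C>\<in>traces M \<phi> A. maximum_sys 0 A \<C>)"
proof -
  define k where "k = length (yvars \<phi>)"
  have k: "0 < k" using pf by (simp add: k_def partitioned_formula_def)
  have "inj (\<lambda>x :: 'm. replicate k x)" using k by (simp add: inj_def)
  then have "infinite (range (\<lambda>x :: 'm. replicate k x))" using inf by (simp add: range_inj_infinite finite_image_iff)
  moreover have "range (\<lambda>x :: 'm. replicate k x) \<subseteq> tuples k" by (auto simp: tuples_def)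
  ultimately have "infinite (tuples k :: 'm list set)" using finite_subset by blast
  then obtain h :: "nat \<Rightarrow> 'm list" where h: "inj h" "range h \<subseteq> tuples k"
    using infinite_countable_subset by blast
  define c :: "'m list" where "c = replicate (length (xvars \<phi>)) undefined"
  define S where "S = {a \<in> range h. holds M \<phi> c a}"
  have "c \<in> tuples (length (xvars \<phi>))" by (simp add: c_def tuples_def)
  then have "S \<in> phi_types M \<phi> (range h)"
    by (intro phi_typesI bexI[of _ c]) (auto simp: S_def)
  then have "{S} \<in> traces M \<phi> (range h)" by (simp add: traces_def)
  moreover have "maximum_sys 0 (range h) {S}" by (rule maximum_sys_0) (auto simp: S_def)
  moreover have "range h \<approx> (UNIV :: nat set)" using h(1) by (rule inj_on_image_eqpoll_self)
  ultimately show ?thesis using h(2) unfolding k_def by blast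
qed

text \<open>For \<open>N > d\<close> the left side is at least \<open>(N / d) ^ d\<close>. If
  \<open>r < d\<close>, then \<open>N powr (r - d)\<close> would tend to 0 while staying above a
  positive constant.\<close>

lemma exponent_le:
  assumes "\<And>N. 0 < N \<Longrightarrow> real (binom_le N d) < real K * real N powr r"
  shows "real d \<le> r"
proof (rule ccontr)
  assume "\<not> real d \<le> r"
  then have lim: "((\<lambda>x. x powr (r - real d)) \<longlongrightarrow> 0) at_top"
    using tendsto_neg_powr[of "r - real d" "\<lambda>x. x" at_top] by (simp add: filterlim_ident)
  have bound: "1 \<le> real d ^ d * (real K * real N powr (r - real d))" if N: "d < N" for N
  proof -
    have "(real N / real d) ^ d \<le> real (N choose d)"
      using binomial_ge_n_over_k_pow_k[of d N] N by simp
    also have "\<dots> \<le> real (binom_le N d)"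
      using N member_le_sum[of d "{..d}" "\<lambda>i. N choose i"] by (simp add: binom_le_def flip: of_nat_sum)
    also have "\<dots> \<le> real K * real N powr r" using assms[of N] N by simp
    \<comment> \<open>For \<open>d = 0\<close> the fraction divides by zero, but its power is still
      1.\<close>
    finally have "real N ^ d \<le> real d ^ d * (real K * real N powr r)"
      by (cases "d = 0") (simp_all add: power_divide field_simps)
    then have "real N ^ d / real N ^ d \<le> real d ^ d * (real K * real N powr r) / real N ^ d"
      by (rule divide_right_mono) simp
    then show ?thesis using N by (simp add: powr_diff powr_realpow)
  qed
  have "((\<lambda>N. real d ^ d * (real K * real N powr (r - real d))) \<longlongrightarrow> real d ^ d * (real K * 0)) sequentially"
    by (intro tendsto_intros filterlim_compose[OF lim filterlim_real_sequentially])
  moreover have "\<forall>\<^sub>F N in sequentially. 1 \<le> real d ^ d * (real K * real N powr (r - real d))"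
    using eventually_gt_at_top[of d] by eventually_elim (rule bound)
  ultimately have "1 \<le> real d ^ d * (real K * 0)"
    by (intro tendsto_lowerbound) auto
  then show False by simp
qed

theorem theorem3p3:
  fixes L :: "('f, 'r) language"
    and T :: "('f, 'r) fm set"
    and M :: "('f, 'r, 'm) struct"
    and \<phi> :: "('f, 'r) part_fm"
  assumes "complete_theory L T"
    and "monster_model L T M"
    and "partitioned_formula L \<phi>"
  shows "ereal_of_enat (VCm M \<phi>) = VCd_ind L M \<phi>"
proof (rule antisym)
  note pf = assms(3)
  note inf = infinite_monster[OF assms(2)]
  have sat: "saturated L M" using assms(2) by (simp add: monster_model_def)
  define D where "D = {d. \<exists>A \<subseteq> tuples (length (yvars \<phi>)). A \<approx> (UNIV :: nat set) \<and>
    (\<exists>\<C> \<in> traces M \<phi> A. maximum_sys d A \<C>)}"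
  have VCm: "VCm M \<phi> = (SUP d\<in>D. enat d)" by (simp add: VCm_def D_def)
  \<comment> \<open>Needed to move the supremum from \<open>enat\<close> to \<open>ereal\<close>,
    where the empty supremum would be minus infinity instead of 0.\<close>
  have "D \<noteq> {}" using exists_maximum_trace_0[OF inf pf, of M] by (auto simp: D_def)
  show "ereal_of_enat (VCm M \<phi>) \<le> VCd_ind L M \<phi>"
    unfolding VCm ereal_of_enat_SUP[OF \<open>D \<noteq> {}\<close>] VCd_ind_def
  proof (intro SUP_least Inf_greatest)
    fix d z assume d: "d \<in> D" and "z \<in> {ereal r |r. VCd_ind_le L M \<phi> r}"
    then obtain r K where z: "z = ereal r" and K: "\<And>bs. bs \<noteq> [] \<Longrightarrow>
      indiscernible L M (length (yvars \<phi>)) bs \<Longrightarrow>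
        real (card (phi_types M \<phi> (set bs))) < real K * real (length bs) powr r"
      by (auto simp: VCd_ind_le_def)
    obtain A \<C> where A: "A \<subseteq> tuples (length (yvars \<phi>))" "A \<approx> (UNIV :: nat set)"
      "\<C> \<subseteq> phi_types M \<phi> A" "maximum_sys d A \<C>"
      using d by (auto simp: D_def traces_def)
    have "real d \<le> r"
    proof (rule exponent_le)
      fix N :: nat assume "0 < N"
      obtain bs where "length bs = N" "indiscernible L M (length (yvars \<phi>)) bs"
        "binom_le N d \<le> card (phi_types M \<phi> (set bs))"
        using maximum_trace_indiscernible[OF sat inf pf A] .
      then show "real (binom_le N d) < real K * real N powr r"
        using K[of bs] \<open>0 < N\<close> by force
    qed
    then show "ereal_of_enat (enat d) \<le> z" by (simp add: z)
  qed
  show "VCd_ind L M \<phi> \<le> ereal_of_enat (VCm M \<phi>)"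
  proof (cases "VCm M \<phi>")
    case (enat d)
    \<comment> \<open>If the exponent \<open>d\<close> failed for every \<open>K\<close>, the large
      type counts would produce a \<open>Suc d\<close>-maximum trace, against the value
      \<open>d\<close> of the supremum.\<close>
    have "VCd_ind_le L M \<phi> (real d)"
    proof (rule ccontr)
      assume "\<not> VCd_ind_le L M \<phi> (real d)"
      then have "\<exists>bs. bs \<noteq> [] \<and> indiscernible L M (length (yvars \<phi>)) bs \<and>
          real K * real (length bs) powr real d \<le> real (card (phi_types M \<phi> (set bs)))" for K
        unfolding VCd_ind_le_def by (meson not_le)
      moreover have "K * length bs ^ d \<le> card (phi_types M \<phi> (set bs))"
        if "bs \<noteq> []"
          "real K * real (length bs) powr real d \<le> real (card (phi_types M \<phi> (set bs)))" for K bs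
        using that by (simp add: powr_realpow flip: of_nat_power of_nat_mult)
      ultimately have "\<exists>bs. bs \<noteq> [] \<and> indiscernible L M (length (yvars \<phi>)) bs \<and>
          K * length bs ^ d \<le> card (phi_types M \<phi> (set bs))" for K
        by meson
      then obtain A \<C> where "A \<subseteq> tuples (length (yvars \<phi>))" "A \<approx> (UNIV :: nat set)"
        "\<C> \<in> traces M \<phi> A" "maximum_sys (Suc d) A \<C>"
        using exists_maximum_trace[OF sat inf pf] by blast
      then have "Suc d \<in> D" by (auto simp: D_def)
      then have "enat (Suc d) \<le> VCm M \<phi>" unfolding VCm by (rule SUP_upper)
      then show False using enat by simp
    qed
    then have "VCd_ind L M \<phi> \<le> ereal (real d)"
      unfolding VCd_ind_def by (intro Inf_lower) blast
    then show ?thesis using enat by simp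
  qed simp
qed

end
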